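(* Let $r$ and $t$ be fixed integers with $r\ge t\ge 2$. Then $\mathrm{rb}(n,B_t,B_r)=(1+o(1))\,n^2/8$ as $n\to\infty$.
   Context: All graphs are finite and simple. The book graph $B_t$ consists of $t$ triangles sharing a common edge (so it has $t+2$ vertices and $2t+1$ edges). A copy of $H$ in a graph $G$ is a (not necessarily induced) subgraph of $G$ isomorphic to $H$. Given a graph $G$ and a family $\mathcal{H}$ of subgraphs of $G$, a subgraph $F$ of $G$ is called rainbow if there is an injection $\phi:E(F)\to\mathcal{H}$ such that each edge $e\in E(F)$ is an edge of $\phi(e)$. For graphs $H,F$ and a positive integer $n$, $\mathrm{rb}(n,H,F)$ denotes the largest cardinality of a family $\mathcal{H}$ of distinct copies of $H$ in an $n$-vertex graph $G$ such that no copy of $F$ in $G$ is rainbow (the maximum is over all $n$-vertex graphs $G$ and all such families). *)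

theory Defs
  imports Complex_Main "HOL-Library.Landau_Symbols"
begin

text \<open>A graph is a pair of a vertex set and an edge set, an edge being the two-element set of its
  endpoints.\<close>

type_synonym 'a graph = "'a set \<times> 'a set set"

abbreviation verts :: "'a graph \<Rightarrow> 'a set" where "verts G \<equiv> fst G"
abbreviation edges :: "'a graph \<Rightarrow> 'a set set" where "edges G \<equiv> snd G"

definition simple_graph :: "'a graph \<Rightarrow> bool" where
  "simple_graph G \<longleftrightarrow> finite (verts G) \<and> (\<forall>e\<in>edges G. e \<subseteq> verts G \<and> card e = 2)"

definition subgraph :: "'a graph \<Rightarrow> 'a graph \<Rightarrow> bool" where
  "subgraph F G \<longleftrightarrow> simple_graph F \<and> verts F \<subseteq> verts G \<and> edges F \<subseteq> edges G"

definition isomorphic :: "'a graph \<Rightarrow> 'b graph \<Rightarrow> bool" where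
  "isomorphic G H \<longleftrightarrow> (\<exists>f. bij_betw f (verts G) (verts H) \<and>
     (\<forall>u\<in>verts G. \<forall>v\<in>verts G. {u, v} \<in> edges G \<longleftrightarrow> {f u, f v} \<in> edges H))"

definition copies :: "'b graph \<Rightarrow> 'a graph \<Rightarrow> 'a graph set" where
  "copies H G = {C. subgraph C G \<and> isomorphic C H}"

definition rainbow :: "'a graph set \<Rightarrow> 'a graph \<Rightarrow> bool" where
  "rainbow \<H> F \<longleftrightarrow> (\<exists>\<phi>. inj_on \<phi> (edges F) \<and> \<phi> ` edges F \<subseteq> \<H> \<and> (\<forall>e\<in>edges F. e \<in> edges (\<phi> e)))"

text \<open>Host graphs may be taken on vertices in \<^typ>\<open>nat\<close> without loss of generality: every finite
  graph is isomorphic to one of these.\<close>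

definition rb_cards :: "nat \<Rightarrow> 'b graph \<Rightarrow> 'c graph \<Rightarrow> nat set" where
  "rb_cards n H F = {card \<H> | (G :: nat graph) \<H>.
     simple_graph G \<and> card (verts G) = n \<and> \<H> \<subseteq> copies H G \<and>
     (\<forall>C\<in>copies F G. \<not> rainbow \<H> C)}"

definition rb :: "nat \<Rightarrow> 'b graph \<Rightarrow> 'c graph \<Rightarrow> nat" where
  "rb n H F = Max (rb_cards n H F)"

text \<open>The triangles \<open>{0, 1, i}\<close> with \<open>2 \<le> i < t + 2\<close> share the edge \<open>{0, 1}\<close>.\<close>

definition book :: "nat \<Rightarrow> nat graph" where
  "book t = ({..<t + 2}, {{0, 1}} \<union> (\<Union>i\<in>{2..<t + 2}. {{0, i}, {1, i}}))"

lemma simple_graph_book: "simple_graph (book t)"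
  by (auto simp: simple_graph_def book_def)

lemma card_verts_book: "card (verts (book t)) = t + 2"
  by (simp add: book_def)

lemma card_edges_book: "card (edges (book t)) = 2 * t + 1"
proof -
  have e: "edges (book t) =
      insert {0, 1} ((\<lambda>i. {0, i}) ` {2..<t + 2} \<union> (\<lambda>i. {1, i}) ` {2..<t + 2})"
    by (auto simp: book_def)
  have inj: "inj_on (\<lambda>i::nat. {0, i}) {2..<t + 2}" "inj_on (\<lambda>i::nat. {1, i}) {2..<t + 2}"
    by (auto simp: inj_on_def doubleton_eq_iff)
  have ne: "{0, i} \<noteq> {1, j}" "{0, 1} \<noteq> {0, i}" "{0, 1} \<noteq> {1, i}"
    if "i \<in> {2..<t + 2}" for i j :: nat
    using that by (auto simp: doubleton_eq_iff)
  have "((\<lambda>i::nat. {0, i}) ` {2..<t + 2}) \<inter> ((\<lambda>i. {1, i}) ` {2..<t + 2}) = {}"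
    using ne(1) by blast
  then have "card ((\<lambda>i::nat. {0, i}) ` {2..<t + 2} \<union> (\<lambda>i. {1, i}) ` {2..<t + 2}) = t + t"
    using inj by (simp add: card_Un_disjoint card_image)
  moreover have "{0, 1::nat} \<notin> (\<lambda>i. {0, i}) ` {2..<t + 2} \<union> (\<lambda>i. {1, i}) ` {2..<t + 2}"
    using ne(2,3) by blast
  ultimately show ?thesis
    by (simp add: e)
qed

text \<open>The maximum defining \<^const>\<open>rb\<close> is over a finite set, nonempty as soon as \<open>F\<close> has an edge.\<close>

lemma finite_rb_cards: "finite (rb_cards n H F)"
proof -
  have "card \<H> \<le> 2 ^ n * 2 ^ (2 ^ n)"
    if "simple_graph G" "card (verts G) = n" "\<H> \<subseteq> copies H G" for G :: "nat graph" and \<H>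
  proof -
    have fin: "finite (verts G)" using that(1) by (simp add: simple_graph_def)
    have "edges G \<subseteq> Pow (verts G)" using that(1) by (auto simp: simple_graph_def)
    then have "C \<in> Pow (verts G) \<times> Pow (Pow (verts G))" if "C \<in> copies H G" for C
      using that by (cases C) (auto simp: copies_def subgraph_def)
    then have "\<H> \<subseteq> Pow (verts G) \<times> Pow (Pow (verts G))"
      using that(3) by blast
    then have "card \<H> \<le> card (Pow (verts G) \<times> Pow (Pow (verts G)))"
      using fin by (intro card_mono) auto
    then show ?thesis
      using fin that(2) by (simp add: card_cartesian_product card_Pow)
  qed
  then have "rb_cards n H F \<subseteq> {..2 ^ n * 2 ^ (2 ^ n)}"
    by (auto simp: rb_cards_def)
  then show ?thesis by (rule finite_subset) simp
qed

lemma rb_cards_nonempty: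
  assumes "simple_graph F" "edges F \<noteq> {}"
  shows "rb_cards n H F \<noteq> {}"
proof -
  have "copies F ({..<n}, {}) = {}"
  proof (rule ccontr)
    assume "copies F ({..<n}, {}) \<noteq> {}"
    then obtain C where "subgraph C ({..<n}, {})" "isomorphic C F"
      by (auto simp: copies_def)
    then obtain f where C: "edges C = {}" "bij_betw f (verts C) (verts F)"
      "\<forall>u\<in>verts C. \<forall>v\<in>verts C. {u, v} \<in> edges C \<longleftrightarrow> {f u, f v} \<in> edges F"
      unfolding subgraph_def isomorphic_def by auto
    from assms obtain e where e: "e \<in> edges F" "e \<subseteq> verts F" "card e = 2"
      by (auto simp: simple_graph_def)
    then obtain x y where xy: "e = {x, y}" unfolding card_2_iff by blast
    with e(2) C(2) have "x \<in> f ` verts C" "y \<in> f ` verts C"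
      by (simp_all add: bij_betw_imp_surj_on)
    then obtain u v where "u \<in> verts C" "v \<in> verts C" "x = f u" "y = f v" by blast
    with C(1,3) e(1) xy show False by simp
  qed
  then have "card ({} :: nat graph set) \<in> rb_cards n H F"
    unfolding rb_cards_def
    by (intro CollectI exI[of _ "({..<n}, {})"] exI[of _ "{}"]) (auto simp: simple_graph_def)
  then show ?thesis by blast
qed

end

theory Submission
  imports Defs "HOL-Analysis.Convex" "HOL-Library.Indicator_Function" "HOL-Real_Asymp.Real_Asymp"
begin

text \<open>Upper bound: call an edge private if exactly one copy of the family contains it, and a triangle
  tied if two of its edges are private to the same copy.  An edge lies in boundedly many triangles
  that are not tied, since otherwise colours can be chosen greedily to give a rainbow \<open>B_r\<close>, and the
  number of tied triangles is \<open>O(n^2)\<close>.  So the edges covered by the family span \<open>O(n^2)\<close> triangles,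
  and by the triangle removal lemma \<open>o(n^2)\<close> edges meet all of them.  Hence only \<open>o(n^2)\<close> triangles,
  and therefore only \<open>o(n^2)\<close> copies, involve no tie.  All other copies have two private edges each,
  and by Mantel's theorem there are at most \<open>n^2 / 4 + o(n^2)\<close> edges to share.\<close>

section \<open>A one-sided regularity lemma\<close>

text \<open>Bounding untied triangles is not enough: in the extremal family every spine lies in
  about \<open>n / 2\<close> tied triangles, so the covered graph is neither triangle-free nor
  locally sparse, and Mantel's theorem does not apply to it directly. What helps is that a tied
  triangle is found from one private edge and a further vertex of its owner, at most
  \<open>t + 2\<close> choices per arc. A total of order n^2 is below \<delta> n^3 for large n,
  which is what removal asks for. A copy with at most one private edge ties none of its triangles,
  so all its pages are free pages of its spine, and the page bound leaves boundedly many such copies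
  per untied triangle. The 8 is Mantel's 4 times the two private edges per copy. The matching
  example is a balanced complete bipartite graph with a perfect or almost perfect matching added on
  one side: both edges at a variable page have the same single colour, so no rainbow book uses that
  page.\<close>

text \<open>Conditional expectation of \<open>f\<close> given the partition of
  \<open>\<Omega>\<close> into fibres of \<open>P\<close>. Coding partitions as labellings turns
  refinement into an implication between equations.\<close>

definition avg :: "'a set \<Rightarrow> ('a \<Rightarrow> 'b) \<Rightarrow> ('a \<Rightarrow> real) \<Rightarrow> 'a \<Rightarrow> real" where
  "avg \<Omega> P f w = (\<Sum>v\<in>{v\<in>\<Omega>. P v = P w}. f v) / real (card {v\<in>\<Omega>. P v = P w})"

lemma avg_cong: "P v = P w \<Longrightarrow> avg \<Omega> P f v = avg \<Omega> P f w"
  by (simp add: avg_def)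

text \<open>The defining property of conditional expectation. It is applied with \<open>g\<close> an
  average itself, for orthogonality, and with \<open>g\<close> the indicator of a union of
  parts.\<close>

lemma sum_avg:
  assumes fin: "finite \<Omega>"
    and g: "\<And>v w. v \<in> \<Omega> \<Longrightarrow> w \<in> \<Omega> \<Longrightarrow> P v = P w \<Longrightarrow> g v = g w"
  shows "(\<Sum>w\<in>\<Omega>. g w * avg \<Omega> P f w) = (\<Sum>w\<in>\<Omega>. g w * f w)"
proof -
  have "(\<Sum>w\<in>{w\<in>\<Omega>. P w = y}. g w * avg \<Omega> P f w) = (\<Sum>w\<in>{w\<in>\<Omega>. P w = y}. g w * f w)"
    if y: "y \<in> P ` \<Omega>" for y
  proof -
    obtain v where v: "v \<in> \<Omega>" "y = P v" using y by blast
    let ?C = "{w\<in>\<Omega>. P w = y}"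
    have c: "card ?C \<noteq> 0" using v fin by auto
    have gv: "g w = g v" if "w \<in> ?C" for w using g[of w v] that v by simp
    have "(\<Sum>w\<in>?C. g w * avg \<Omega> P f w) = (\<Sum>w\<in>?C. g v * (sum f ?C / card ?C))"
      using gv by (intro sum.cong) (auto simp: avg_def)
    also have "\<dots> = g v * sum f ?C" using c by simp
    also have "\<dots> = (\<Sum>w\<in>?C. g w * f w)"
      unfolding sum_distrib_left using gv by (intro sum.cong) auto
    finally show ?thesis .
  qed
  then show ?thesis
    using sum.image_gen[OF fin, of "\<lambda>w. g w * avg \<Omega> P f w" P]
      sum.image_gen[OF fin, of "\<lambda>w. g w * f w" P] by simp
qed

lemma avg_bounds:
  assumes "finite \<Omega>" "\<And>w. 0 \<le> f w" "\<And>w. f w \<le> 1"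
  shows "0 \<le> avg \<Omega> P f w" "avg \<Omega> P f w \<le> 1"
proof -
  let ?C = "{v\<in>\<Omega>. P v = P w}"
  have "sum f ?C \<le> (\<Sum>v\<in>?C. 1)" using assms by (intro sum_mono) auto
  then show "avg \<Omega> P f w \<le> 1" by (cases "card ?C = 0") (auto simp: avg_def divide_simps)
  show "0 \<le> avg \<Omega> P f w" using assms by (simp add: avg_def sum_nonneg)
qed

text \<open>For a refinement \<open>P'\<close> of \<open>P\<close>, both inner products of
  \<open>avg \<Omega> P f\<close>, with itself and with \<open>avg \<Omega> P' f\<close>, equal its
  inner product with \<open>f\<close>; so it is orthogonal to the increment.\<close>

lemma avg_pythagoras:
  assumes fin: "finite \<Omega>"
    and ref: "\<And>v w. v \<in> \<Omega> \<Longrightarrow> w \<in> \<Omega> \<Longrightarrow> P' v = P' w \<Longrightarrow> P v = P w"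
  shows "(\<Sum>w\<in>\<Omega>. (avg \<Omega> P' f w)\<^sup>2)
       = (\<Sum>w\<in>\<Omega>. (avg \<Omega> P f w)\<^sup>2) + (\<Sum>w\<in>\<Omega>. (avg \<Omega> P' f w - avg \<Omega> P f w)\<^sup>2)"
proof -
  have 1: "(\<Sum>w\<in>\<Omega>. avg \<Omega> P f w * avg \<Omega> P' f w) = (\<Sum>w\<in>\<Omega>. avg \<Omega> P f w * f w)"
    by (intro sum_avg fin avg_cong) (rule ref)
  have 2: "(\<Sum>w\<in>\<Omega>. avg \<Omega> P f w * avg \<Omega> P f w) = (\<Sum>w\<in>\<Omega>. avg \<Omega> P f w * f w)"
    by (intro sum_avg fin avg_cong) auto
  have "(\<Sum>w\<in>\<Omega>. (avg \<Omega> P' f w - avg \<Omega> P f w)\<^sup>2) =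
     (\<Sum>w\<in>\<Omega>. (avg \<Omega> P' f w)\<^sup>2) + (\<Sum>w\<in>\<Omega>. (avg \<Omega> P f w)\<^sup>2)
       - 2 * (\<Sum>w\<in>\<Omega>. avg \<Omega> P f w * avg \<Omega> P' f w)"
    by (simp add: power2_diff sum.distrib sum_subtractf sum_distrib_left mult_ac)
  then show ?thesis using 1 2 by (simp add: power2_eq_square)
qed

section \<open>Edge densities, irregular pairs and the energy increment\<close>

text \<open>An empty side gives density 0 through division by zero, so a positive lower bound on a
  density also makes both sides nonempty.\<close>

definition dens :: "('a \<times> 'a) set \<Rightarrow> 'a set \<Rightarrow> 'a set \<Rightarrow> real" where
  "dens E X Y = real (card (E \<inter> X \<times> Y)) / (real (card X) * real (card Y))"

text \<open>Only a drop of density matters for counting triangles, so regularity is one-sided.\<close>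

definition bad :: "real \<Rightarrow> ('a \<times> 'a) set \<Rightarrow> 'a set \<Rightarrow> 'a set \<Rightarrow> bool" where
  "bad \<epsilon> E X Y \<longleftrightarrow> 2 * \<epsilon> \<le> dens E X Y \<and>
     (\<exists>X' Y'. X' \<subseteq> X \<and> Y' \<subseteq> Y \<and> \<epsilon> * card X \<le> card X' \<and> \<epsilon> * card Y \<le> card Y' \<and> dens E X' Y' < \<epsilon>)"

text \<open>Pairs of vertices instead of pairs of parts: the weight of a pair of parts, the product
  of the sizes, is then built into the cardinality.\<close>

definition bad_pairs :: "real \<Rightarrow> ('a \<times> 'a) set \<Rightarrow> 'a set \<Rightarrow> ('a \<Rightarrow> nat) \<Rightarrow> ('a \<times> 'a) set" where
  "bad_pairs \<epsilon> E V p = {(x, y) \<in> V \<times> V. bad \<epsilon> E {v\<in>V. p v = p x} {v\<in>V. p v = p y}}"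

text \<open>The mean square density of a partition, left unnormalised and written over vertex pairs,
  so that it is the squared norm of a conditional expectation.\<close>

definition energy :: "('a \<times> 'a) set \<Rightarrow> 'a set \<Rightarrow> ('a \<Rightarrow> nat) \<Rightarrow> real" where
  "energy E V p = (\<Sum>w\<in>V \<times> V. (avg (V \<times> V) (map_prod p p) (indicator E) w)\<^sup>2)"

lemma energy_le:
  assumes "finite V"
  shows "energy E V p \<le> (real (card V))\<^sup>2"
proof -
  have "energy E V p \<le> (\<Sum>w\<in>V \<times> V. 1)"
    unfolding energy_def
    using avg_bounds[of "V \<times> V" "indicator E" "map_prod p p"] assms
    by (intro sum_mono power_le_one) (auto simp: indicator_def)
  then show ?thesis by (simp add: card_cartesian_product power2_eq_square)
qed

lemma avg_dens:
  assumes "finite V" "x \<in> V" "y \<in> V"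
  shows "avg (V \<times> V) (map_prod p p) (indicator E) (x, y)
       = dens E {v\<in>V. p v = p x} {v\<in>V. p v = p y}"
proof -
  let ?X = "{v\<in>V. p v = p x}" and ?Y = "{v\<in>V. p v = p y}"
  have e: "{w \<in> V \<times> V. map_prod p p w = map_prod p p (x, y)} = ?X \<times> ?Y" by auto
  have "(\<Sum>w\<in>?X \<times> ?Y. indicator E w :: real) = card (E \<inter> ?X \<times> ?Y)"
    using sum_mult_indicator[of "?X \<times> ?Y" "\<lambda>_. 1::real" E] assms(1) by (simp add: Int_commute)
  then show ?thesis
    unfolding avg_def e dens_def by (simp add: card_cartesian_product)
qed

lemma sum_square_le_card_mult:
  fixes h :: "'a \<Rightarrow> real"
  assumes "finite A"
  shows "(sum h A)\<^sup>2 \<le> card A * (\<Sum>x\<in>A. (h x)\<^sup>2)"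
  using Cauchy_Schwarz_ineq_sum[of "\<lambda>_. 1" h A] by simp

text \<open>Returns composite labels to an initial segment of the naturals, so that refinement can
  be iterated while the number of parts is tracked.\<close>

lemma relabel_nat:
  assumes "finite V" "g ` V \<subseteq> S" "finite S" "card S \<le> m"
  obtains p :: "'a \<Rightarrow> nat" where "p ` V \<subseteq> {..<m}" "\<And>x y. x \<in> V \<Longrightarrow> y \<in> V \<Longrightarrow> p x = p y \<longleftrightarrow> g x = g y"
proof -
  obtain h where h: "bij_betw h S {0..<card S}" using ex_bij_betw_finite_nat assms by blast
  show ?thesis
  proof (rule that[of "h \<circ> g"])
    show "(h \<circ> g) ` V \<subseteq> {..<m}"
    proof
      fix y assume "y \<in> (h \<circ> g) ` V"
      then obtain x where x: "x \<in> V" "y = h (g x)" by auto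
      then have "h (g x) \<in> {0..<card S}" using assms(2) bij_betwE[OF h] by blast
      then show "y \<in> {..<m}" using x assms(4) by auto
    qed
    show "(h \<circ> g) x = (h \<circ> g) y \<longleftrightarrow> g x = g y" if "x \<in> V" "y \<in> V" for x y
      using that assms(2) inj_on_eq_iff[OF bij_betw_imp_inj_on[OF h], of "g x" "g y"] by auto
  qed
qed

text \<open>Every part is cut by all its witness sets at once. On the witness rectangle of a bad
  pair the density drops by at least \<epsilon>, so Cauchy-Schwarz gives a gain of \<epsilon>^2
  times its area, which is at least \<epsilon>^2 of the whole pair. The bad pairs have total area
  above \<epsilon> n^2, whence \<epsilon>^5.\<close>

lemma energy_increment:
  fixes V :: "'a set" and p :: "'a \<Rightarrow> nat"
  assumes fin: "finite V" and \<epsilon>: "0 < \<epsilon>" and p: "p ` V \<subseteq> {..<k}"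
    and irr: "\<epsilon> * (real (card V))\<^sup>2 < card (bad_pairs \<epsilon> E V p)"
  obtains p' :: "'a \<Rightarrow> nat" where "p' ` V \<subseteq> {..<k * (2 ^ k * 2 ^ k)}"
    "energy E V p + \<epsilon> ^ 5 * (real (card V))\<^sup>2 \<le> energy E V p'"
proof -
  define C where "C i = {v\<in>V. p v = i}" for i
  define B where "B = {(i, j) \<in> {..<k} \<times> {..<k}. bad \<epsilon> E (C i) (C j)}"
  have "\<forall>ij\<in>B. \<exists>XY. fst XY \<subseteq> C (fst ij) \<and> snd XY \<subseteq> C (snd ij) \<and> \<epsilon> * card (C (fst ij)) \<le> card (fst XY)
     \<and> \<epsilon> * card (C (snd ij)) \<le> card (snd XY) \<and> dens E (fst XY) (snd XY) < \<epsilon>"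
    unfolding B_def bad_def by auto
  then obtain W where W: "\<And>ij. ij \<in> B \<Longrightarrow> fst (W ij) \<subseteq> C (fst ij) \<and> snd (W ij) \<subseteq> C (snd ij)
     \<and> \<epsilon> * card (C (fst ij)) \<le> card (fst (W ij)) \<and> \<epsilon> * card (C (snd ij)) \<le> card (snd (W ij))
     \<and> dens E (fst (W ij)) (snd (W ij)) < \<epsilon>"
    by metis
  \<comment> \<open>The old label together with the sets of first and of second witnesses containing
    \<open>v\<close>: this accounts for the factors \<open>k\<close>, \<open>2 ^ k\<close> and
    \<open>2 ^ k\<close>.\<close>
  define g where "g v = (p v, {j\<in>{..<k}. v \<in> fst (W (p v, j))}, {i\<in>{..<k}. v \<in> snd (W (i, p v))})" for v
  have "g ` V \<subseteq> {..<k} \<times> Pow {..<k} \<times> Pow {..<k}" using p by (auto simp: g_def)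
  then obtain p' :: "'a \<Rightarrow> nat" where p': "p' ` V \<subseteq> {..<k * (2 ^ k * 2 ^ k)}"
    and p'g: "\<And>x y. x \<in> V \<Longrightarrow> y \<in> V \<Longrightarrow> p' x = p' y \<longleftrightarrow> g x = g y"
    by (rule relabel_nat[OF fin]) (auto simp: card_cartesian_product card_Pow)
  let ?O = "V \<times> V" and ?P = "map_prod p p" and ?P' = "map_prod p' p'"
  let ?f = "indicator E :: 'a \<times> 'a \<Rightarrow> real"
  define h where "h w = avg ?O ?P' ?f w - avg ?O ?P ?f w" for w
  define A where "A ij = fst (W ij) \<times> snd (W ij)" for ij
  have finO: "finite ?O" using fin by simp
  have finC: "finite (C i)" for i using fin by (simp add: C_def)
  have AC: "A ij \<subseteq> C (fst ij) \<times> C (snd ij)" if "ij \<in> B" for ij using W[OF that] by (auto simp: A_def)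
  have CO: "C i \<times> C j \<subseteq> ?O" for i j by (auto simp: C_def)
  have finA: "finite (A ij)" if "ij \<in> B" for ij using AC[OF that] finC by (meson finite_SigmaI finite_subset)
  have gain: "\<epsilon> ^ 4 * (card (C (fst ij)) * card (C (snd ij))) \<le> (\<Sum>w\<in>A ij. (h w)\<^sup>2)" if ij: "ij \<in> B" for ij
  proof -
    obtain i j where ijeq: "ij = (i, j)" by (cases ij)
    let ?X = "fst (W ij)" and ?Y = "snd (W ij)"
    have bd: "i < k" "j < k" "2 * \<epsilon> \<le> dens E (C i) (C j)" using ij by (auto simp: B_def bad_def ijeq)
    have w: "?X \<subseteq> C i" "?Y \<subseteq> C j" "\<epsilon> * card (C i) \<le> card ?X" "\<epsilon> * card (C j) \<le> card ?Y" "dens E ?X ?Y < \<epsilon>"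
      using W[OF ij] by (auto simp: ijeq)
    have "dens E (C i) (C j) \<noteq> 0" using bd \<epsilon> by auto
    then have "card (C i) > 0" "card (C j) > 0" unfolding dens_def by (metis div_by_0 gr0I mult_eq_0_iff of_nat_0)+
    then have "0 < \<epsilon> * card (C i)" "0 < \<epsilon> * card (C j)" using \<epsilon> by auto
    then have pos: "0 < card ?X" "0 < card ?Y" using w(3,4) by linarith+
    have cA: "card (A ij) = card ?X * card ?Y" by (simp add: A_def card_cartesian_product)
    have AO: "A ij \<subseteq> ?O" using AC[OF ij] CO by blast
    have int: "?O \<inter> A ij = A ij" using AO by blast
    \<comment> \<open>Membership in the rectangle can be read off from \<open>g\<close>, so
      \<open>A ij\<close> is a union of cells of the new product partition and averaging over these
      cells keeps the sum. The old average, in contrast, is constant on \<open>A ij\<close>.\<close>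
    have s1: "(\<Sum>w\<in>A ij. avg ?O ?P' ?f w) = (\<Sum>w\<in>A ij. ?f w)"
    proof -
      have "(\<Sum>w\<in>?O. indicator (A ij) w * avg ?O ?P' ?f w) = (\<Sum>w\<in>?O. indicator (A ij) w * ?f w)"
      proof (rule sum_avg[OF finO])
        fix v w assume vw: "v \<in> ?O" "w \<in> ?O" "?P' v = ?P' w"
        obtain v1 v2 w1 w2 where e: "v = (v1, v2)" "w = (w1, w2)" by (cases v, cases w)
        have "g v1 = g w1" "g v2 = g w2" using vw p'g by (auto simp: e)
        moreover have "v1 \<in> ?X \<longleftrightarrow> p v1 = i \<and> j \<in> fst (snd (g v1))" if "v1 \<in> V" for v1
          using w(1) bd(2) by (auto simp: g_def C_def ijeq)
        moreover have "v2 \<in> ?Y \<longleftrightarrow> p v2 = j \<and> i \<in> snd (snd (g v2))" if "v2 \<in> V" for v2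
          using w(2) bd(1) by (auto simp: g_def C_def ijeq)
        moreover have "fst (g v) = p v" for v by (simp add: g_def)
        ultimately have "v \<in> A ij \<longleftrightarrow> w \<in> A ij"
          using vw(1,2) unfolding A_def e by (metis mem_Sigma_iff)
        then show "indicator (A ij) v = (indicator (A ij) w :: real)" by (simp add: indicator_def)
      qed
      then show ?thesis unfolding sum_indicator_mult[OF finO] int .
    qed
    have s2: "(\<Sum>w\<in>A ij. avg ?O ?P ?f w) = card (A ij) * dens E (C i) (C j)"
    proof -
      have "avg ?O ?P ?f w = dens E (C i) (C j)" if "w \<in> A ij" for w
        using that AC[OF ij] avg_dens[OF fin, of "fst w" "snd w" p E] by (auto simp: C_def ijeq)
      then show ?thesis by simp
    qed
    have s3: "(\<Sum>w\<in>A ij. ?f w) = card (A ij) * dens E ?X ?Y"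
    proof -
      have "(\<Sum>w\<in>A ij. ?f w) = card (E \<inter> A ij)"
        using sum_mult_indicator[OF finA[OF ij], of "\<lambda>_. 1::real" E] by (simp add: Int_commute)
      also have "\<dots> = card (A ij) * dens E ?X ?Y" using pos by (simp add: dens_def cA) (simp add: A_def)
      finally show ?thesis .
    qed
    have "(\<Sum>w\<in>A ij. h w) = card (A ij) * (dens E ?X ?Y - dens E (C i) (C j))"
      unfolding h_def sum_subtractf s1 s2 s3 by (simp add: algebra_simps)
    also have "\<dots> \<le> card (A ij) * (- \<epsilon>)" using bd(3) w(5) by (intro mult_left_mono) auto
    finally have "card (A ij) * \<epsilon> \<le> - (\<Sum>w\<in>A ij. h w)" by simp
    then have "(card (A ij) * \<epsilon>)\<^sup>2 \<le> (\<Sum>w\<in>A ij. h w)\<^sup>2"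
      using \<epsilon> power_mono[of "card (A ij) * \<epsilon>" "- (\<Sum>w\<in>A ij. h w)" 2] by simp
    also have "\<dots> \<le> card (A ij) * (\<Sum>w\<in>A ij. (h w)\<^sup>2)"
      by (rule sum_square_le_card_mult[OF finA[OF ij]])
    finally have "card (A ij) * \<epsilon>\<^sup>2 \<le> (\<Sum>w\<in>A ij. (h w)\<^sup>2)"
      using pos cA by (simp add: power2_eq_square mult_ac)
    moreover have "(\<epsilon> * card (C i)) * (\<epsilon> * card (C j)) \<le> real (card ?X) * card ?Y"
      using w(3,4) \<epsilon> by (intro mult_mono) auto
    then have "\<epsilon>\<^sup>2 * ((\<epsilon> * card (C i)) * (\<epsilon> * card (C j))) \<le> \<epsilon>\<^sup>2 * card (A ij)"
      unfolding cA by (intro mult_left_mono) auto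
    ultimately show ?thesis by (simp add: ijeq power_numeral_reduce mult_ac)
  qed
  have finB: "finite B" unfolding B_def by (rule finite_subset[of _ "{..<k} \<times> {..<k}"]) auto
  have "bad_pairs \<epsilon> E V p = (\<Union>ij\<in>B. C (fst ij) \<times> C (snd ij))"
    using p unfolding bad_pairs_def B_def C_def by (auto; fastforce)
  also have "card \<dots> \<le> (\<Sum>ij\<in>B. card (C (fst ij) \<times> C (snd ij)))"
    by (rule card_UN_le[OF finB])
  finally have "real (card (bad_pairs \<epsilon> E V p)) \<le> (\<Sum>ij\<in>B. real (card (C (fst ij)) * card (C (snd ij))))"
    unfolding card_cartesian_product by (metis of_nat_mono of_nat_sum)
  with irr have "\<epsilon> * (real (card V))\<^sup>2 \<le> (\<Sum>ij\<in>B. real (card (C (fst ij)) * card (C (snd ij))))" by linarith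
  then have "\<epsilon> ^ 4 * (\<epsilon> * (real (card V))\<^sup>2) \<le> \<epsilon> ^ 4 * (\<Sum>ij\<in>B. real (card (C (fst ij)) * card (C (snd ij))))"
    using \<epsilon> by (intro mult_left_mono) auto
  also have "\<dots> \<le> (\<Sum>ij\<in>B. \<Sum>w\<in>A ij. (h w)\<^sup>2)"
    unfolding sum_distrib_left by (intro sum_mono gain)
  \<comment> \<open>Rectangles of different pairs lie in different cells of the old product
    partition, so the gains add up.\<close>
  also have "\<dots> = (\<Sum>w\<in>(\<Union>ij\<in>B. A ij). (h w)\<^sup>2)"
  proof (rule sum.UNION_disjoint[symmetric, OF finB])
    show "\<forall>i\<in>B. finite (A i)" using finA by blast
    show "\<forall>i\<in>B. \<forall>j\<in>B. i \<noteq> j \<longrightarrow> A i \<inter> A j = {}"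
    proof (intro ballI impI)
      fix i j assume "i \<in> B" "j \<in> B" "i \<noteq> j"
      then have "C (fst i) \<times> C (snd i) \<inter> C (fst j) \<times> C (snd j) = {}"
        by (cases i; cases j) (auto simp: C_def)
      then show "A i \<inter> A j = {}" using AC \<open>i \<in> B\<close> \<open>j \<in> B\<close> by blast
    qed
  qed
  also have "\<dots> \<le> (\<Sum>w\<in>?O. (h w)\<^sup>2)"
    using AC CO by (intro sum_mono2[OF finO]) (blast, auto)
  also have "energy E V p + \<dots> = energy E V p'"
    unfolding energy_def h_def
  proof (rule avg_pythagoras[OF finO, symmetric])
    fix v w assume "v \<in> ?O" "w \<in> ?O" "?P' v = ?P' w"
    then show "?P v = ?P w" using p'g by (cases v; cases w) (auto simp: g_def)
  qed
  finally have "energy E V p + \<epsilon> ^ 5 * (real (card V))\<^sup>2 \<le> energy E V p'"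
    by (simp add: power_numeral_reduce mult_ac)
  with p' show ?thesis by (rule that)
qed

text \<open>Here \<open>j\<close> is a budget of increments: each failure of regularity raises the
  energy by \<epsilon>^5 n^2, and the energy never exceeds n^2. The bound \<open>K\<close> is chosen
  before \<open>V\<close>, \<open>E\<close> and \<open>p\<close>, so it is uniform over all
  graphs.\<close>

lemma regular_partition_aux:
  fixes j k :: nat and \<epsilon> :: real
  assumes \<epsilon>: "0 < \<epsilon>"
  shows "\<exists>K. \<forall>V (E :: ('a \<times> 'a) set) p. finite V \<longrightarrow> V \<noteq> {} \<longrightarrow> p ` V \<subseteq> {..<k} \<longrightarrow>
     (1 - j * \<epsilon> ^ 5) * (real (card V))\<^sup>2 < energy E V p \<longrightarrow>
     (\<exists>p'. p' ` V \<subseteq> {..<K} \<and> card (bad_pairs \<epsilon> E V p') \<le> \<epsilon> * (real (card V))\<^sup>2)"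
proof (induction j arbitrary: k)
  case 0
  \<comment> \<open>An exhausted budget contradicts \<open>energy_le\<close>, so any bound will
    do.\<close>
  show ?case
    using energy_le by (intro exI[of _ 0]) (fastforce simp: not_less[symmetric])
next
  case (Suc j)
  obtain K where K: "\<And>V (E :: ('a \<times> 'a) set) p. finite V \<Longrightarrow> V \<noteq> {} \<Longrightarrow> p ` V \<subseteq> {..<k * (2 ^ k * 2 ^ k)} \<Longrightarrow>
     (1 - j * \<epsilon> ^ 5) * (real (card V))\<^sup>2 < energy E V p \<Longrightarrow>
     (\<exists>p'. p' ` V \<subseteq> {..<K} \<and> card (bad_pairs \<epsilon> E V p') \<le> \<epsilon> * (real (card V))\<^sup>2)"
    using Suc.IH[of "k * (2 ^ k * 2 ^ k)"] by blast
  show ?case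
  proof (intro exI[of _ "max k K"] allI impI)
    fix V :: "'a set" and E :: "('a \<times> 'a) set" and p :: "'a \<Rightarrow> nat"
    assume a: "finite V" "V \<noteq> {}" "p ` V \<subseteq> {..<k}"
      "(1 - (Suc j) * \<epsilon> ^ 5) * (real (card V))\<^sup>2 < energy E V p"
    show "\<exists>p'. p' ` V \<subseteq> {..<max k K} \<and> card (bad_pairs \<epsilon> E V p') \<le> \<epsilon> * (real (card V))\<^sup>2"
    proof (cases "card (bad_pairs \<epsilon> E V p) \<le> \<epsilon> * (real (card V))\<^sup>2")
      case True
      then show ?thesis using a(3) by (intro exI[of _ p]) auto
    next
      case False
      then obtain p' :: "'a \<Rightarrow> nat" where p': "p' ` V \<subseteq> {..<k * (2 ^ k * 2 ^ k)}"
        "energy E V p + \<epsilon> ^ 5 * (real (card V))\<^sup>2 \<le> energy E V p'"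
        using energy_increment[OF a(1) \<epsilon> a(3)] by (metis not_le)
      have "(1 - j * \<epsilon> ^ 5) * (real (card V))\<^sup>2 < energy E V p'"
        using a(4) p'(2) by (simp add: algebra_simps)
      from K[OF a(1,2) p'(1) this] show ?thesis by (fastforce simp: less_max_iff_disj)
    qed
  qed
qed

lemma regular_partition:
  assumes \<epsilon>: "0 < \<epsilon>"
  obtains K where "\<And>V (E :: ('a \<times> 'a) set). finite V \<Longrightarrow>
     \<exists>p. p ` V \<subseteq> {..<K} \<and> card (bad_pairs \<epsilon> E V p) \<le> \<epsilon> * (real (card V))\<^sup>2"
proof -
  \<comment> \<open>This choice makes the required lower bound on the energy negative, so the
    one-part partition may start the iteration.\<close>
  obtain j where j: "1 < real j * \<epsilon> ^ 5"
    using \<epsilon> by (metis ex_less_of_nat_mult zero_less_power)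
  obtain K where K: "\<And>V (E :: ('a \<times> 'a) set) p. finite V \<Longrightarrow> V \<noteq> {} \<Longrightarrow> p ` V \<subseteq> {..<1} \<Longrightarrow>
     (1 - j * \<epsilon> ^ 5) * (real (card V))\<^sup>2 < energy E V p \<Longrightarrow>
     (\<exists>p'. p' ` V \<subseteq> {..<K} \<and> card (bad_pairs \<epsilon> E V p') \<le> \<epsilon> * (real (card V))\<^sup>2)"
    using regular_partition_aux[OF \<epsilon>, of 1 j] by blast
  show ?thesis
  proof (rule that[of K])
    fix V :: "'a set" and E :: "('a \<times> 'a) set"
    assume V: "finite V"
    show "\<exists>p. p ` V \<subseteq> {..<K} \<and> card (bad_pairs \<epsilon> E V p) \<le> \<epsilon> * (real (card V))\<^sup>2"
    proof (cases "V = {}")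
      case True
      then show ?thesis by (simp add: bad_pairs_def)
    next
      case False
      have "(1 - j * \<epsilon> ^ 5) * (real (card V))\<^sup>2 < 0"
        using False V j by (intro mult_neg_pos) auto
      also have "0 \<le> energy E V (\<lambda>_. 0)" by (simp add: energy_def sum_nonneg)
      finally show ?thesis using K[OF V False, of "\<lambda>_. 0"] by auto
    qed
  qed
qed

section \<open>Triangle removal and Mantel's theorem\<close>

text \<open>Otherwise the vertices of low degree, paired with all of \<open>Y\<close>, would witness
  a drop of density below \<epsilon>.\<close>

lemma few_small_degree:
  fixes \<epsilon> :: real
  assumes fin: "finite X" "finite Y" and \<epsilon>: "0 < \<epsilon>" "\<epsilon> \<le> 1"
    and XY: "2 * \<epsilon> \<le> dens E X Y" "\<not> bad \<epsilon> E X Y"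
  shows "card {x\<in>X. card {y\<in>Y. (x, y) \<in> E} < \<epsilon> * card Y} < \<epsilon> * card X"
proof (rule ccontr)
  let ?X = "{x\<in>X. card {y\<in>Y. (x, y) \<in> E} < \<epsilon> * card Y}"
  assume "\<not> ?thesis"
  then have big: "\<epsilon> * card X \<le> card ?X" by simp
  have "card X > 0" "card Y > 0" using XY(1) \<epsilon> by (auto simp: dens_def intro!: gr0I)
  then have "0 < \<epsilon> * card X" using \<epsilon> by simp
  then have ne: "0 < card ?X" using big by linarith
  have "E \<inter> ?X \<times> Y = Sigma ?X (\<lambda>x. {y\<in>Y. (x, y) \<in> E})" by auto
  then have "real (card (E \<inter> ?X \<times> Y)) = (\<Sum>x\<in>?X. real (card {y\<in>Y. (x, y) \<in> E}))"
    using fin by simp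
  also have "\<dots> < (\<Sum>x\<in>?X. \<epsilon> * card Y)"
    using ne fin by (intro sum_strict_mono) (auto simp: card_gt_0_iff)
  finally have "dens E ?X Y < \<epsilon>"
    using ne \<open>card Y > 0\<close> by (simp add: dens_def divide_simps mult_ac)
  moreover have "\<epsilon> * card Y \<le> card Y" using \<epsilon> by (simp add: mult_left_le_one_le)
  ultimately have "bad \<epsilon> E X Y"
    unfolding bad_def using XY(1) big by (intro conjI exI[of _ ?X] exI[of _ Y]) simp_all
  with XY(2) show False ..
qed

text \<open>Low degree into \<open>Y\<close> or \<open>Z\<close> costs at most a 2 \<epsilon> \<le>
  1/2 fraction of \<open>X\<close>. For any other \<open>x\<close> both neighbourhoods are large
  enough for regularity of \<open>(Y, Z)\<close> to apply, which gives one factor \<epsilon> for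
  each neighbourhood and one for the density between them.\<close>

lemma triangle_counting:
  fixes \<epsilon> :: real
  assumes fin: "finite X" "finite Y" "finite Z" and \<epsilon>: "0 < \<epsilon>" "\<epsilon> \<le> 1 / 4"
    and XY: "2 * \<epsilon> \<le> dens E X Y" "\<not> bad \<epsilon> E X Y"
    and XZ: "2 * \<epsilon> \<le> dens E X Z" "\<not> bad \<epsilon> E X Z"
    and YZ: "2 * \<epsilon> \<le> dens E Y Z" "\<not> bad \<epsilon> E Y Z"
  shows "\<epsilon> ^ 3 / 2 * card X * card Y * card Z
    \<le> card {(x, y, z) \<in> X \<times> Y \<times> Z. (x, y) \<in> E \<and> (y, z) \<in> E \<and> (x, z) \<in> E}"
proof -
  define NY where "NY x = {y\<in>Y. (x, y) \<in> E}" for x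
  define NZ where "NZ x = {z\<in>Z. (x, z) \<in> E}" for x
  define X' where "X' = {x\<in>X. \<epsilon> * card Y \<le> card (NY x) \<and> \<epsilon> * card Z \<le> card (NZ x)}"
  have pos: "card Y > 0" "card Z > 0" using YZ(1) \<epsilon> by (auto simp: dens_def intro!: gr0I)
  have finN: "finite (NY x)" "finite (NZ x)" for x using fin by (auto simp: NY_def NZ_def)
  have "card X \<le> card (X' \<union> ({x\<in>X. card (NY x) < \<epsilon> * card Y} \<union> {x\<in>X. card (NZ x) < \<epsilon> * card Z}))"
    using fin by (intro card_mono) (auto simp: X'_def)
  also have "\<dots> \<le> card X' + (card {x\<in>X. card (NY x) < \<epsilon> * card Y} + card {x\<in>X. card (NZ x) < \<epsilon> * card Z})"
    by (meson add_left_mono card_Un_le order_trans)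
  finally have "real (card X) \<le> card X' + (real (card {x\<in>X. card (NY x) < \<epsilon> * card Y}) + card {x\<in>X. card (NZ x) < \<epsilon> * card Z})"
    by linarith
  moreover have "card {x\<in>X. card (NY x) < \<epsilon> * card Y} < \<epsilon> * card X"
    unfolding NY_def using few_small_degree[OF _ _ _ _ XY] fin \<epsilon> by auto
  moreover have "card {x\<in>X. card (NZ x) < \<epsilon> * card Z} < \<epsilon> * card X"
    unfolding NZ_def using few_small_degree[OF _ _ _ _ XZ] fin \<epsilon> by auto
  ultimately have "real (card X) - 2 * (\<epsilon> * card X) \<le> card X'" by linarith
  moreover have "\<epsilon> * card X \<le> 1 / 4 * card X" using \<epsilon> by (intro mult_right_mono) auto
  ultimately have X': "card X / 2 \<le> real (card X')" by linarith
  have nb: "\<epsilon> ^ 3 * card Y * card Z \<le> card (E \<inter> NY x \<times> NZ x)" if x: "x \<in> X'" for x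
  proof -
    have x': "\<epsilon> * card Y \<le> card (NY x)" "\<epsilon> * card Z \<le> card (NZ x)" using x by (auto simp: X'_def)
    have d: "\<epsilon> \<le> dens E (NY x) (NZ x)"
    proof (rule ccontr)
      assume "\<not> ?thesis"
      then have "dens E (NY x) (NZ x) < \<epsilon>" by simp
      moreover have "NY x \<subseteq> Y" "NZ x \<subseteq> Z" by (auto simp: NY_def NZ_def)
      ultimately have "bad \<epsilon> E Y Z" using YZ(1) x' unfolding bad_def by blast
      with YZ(2) show False ..
    qed
    have "0 < \<epsilon> * card Y" "0 < \<epsilon> * card Z" using pos \<epsilon> by auto
    then have "0 < real (card (NY x))" "0 < real (card (NZ x))" using x' by linarith+
    then have "\<epsilon> * (real (card (NY x)) * card (NZ x)) \<le> card (E \<inter> NY x \<times> NZ x)"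
      using d by (simp add: dens_def divide_simps mult_ac)
    moreover have "(\<epsilon> * card Y) * (\<epsilon> * card Z) \<le> real (card (NY x)) * card (NZ x)"
      using x' \<epsilon> by (intro mult_mono) auto
    then have "\<epsilon> * ((\<epsilon> * card Y) * (\<epsilon> * card Z)) \<le> \<epsilon> * (real (card (NY x)) * card (NZ x))"
      using \<epsilon> by (intro mult_left_mono) auto
    ultimately show ?thesis by (simp add: power3_eq_cube mult_ac)
  qed
  have "\<epsilon> ^ 3 / 2 * card X * card Y * card Z = card X / 2 * (\<epsilon> ^ 3 * card Y * card Z)" by simp
  also have "\<dots> \<le> card X' * (\<epsilon> ^ 3 * card Y * card Z)"
    using X' \<epsilon> by (intro mult_right_mono) auto
  also have "\<dots> \<le> (\<Sum>x\<in>X'. real (card (E \<inter> NY x \<times> NZ x)))"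
    using sum_mono[of X' "\<lambda>_. \<epsilon> ^ 3 * card Y * card Z", OF nb] by simp
  also have "\<dots> = card (Sigma X' (\<lambda>x. E \<inter> NY x \<times> NZ x))"
    using fin finN by (subst card_SigmaI) (auto simp: X'_def)
  also have "\<dots> \<le> card {(x, y, z) \<in> X \<times> Y \<times> Z. (x, y) \<in> E \<and> (y, z) \<in> E \<and> (x, z) \<in> E}"
  proof (intro of_nat_mono card_mono)
    show "finite {(x, y, z) \<in> X \<times> Y \<times> Z. (x, y) \<in> E \<and> (y, z) \<in> E \<and> (x, z) \<in> E}"
      by (rule finite_subset[of _ "X \<times> Y \<times> Z"]) (auto simp: fin)
  qed (auto simp: X'_def NY_def NZ_def)
  finally show ?thesis .
qed

section \<open>The triangle removal lemma\<close>

text \<open>Triples are ordered and need not be distinct: a loop yields the triple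
  \<open>(x, x, x)\<close>, so having no triangles includes having no loops.\<close>

definition triangles :: "('a \<times> 'a) set \<Rightarrow> ('a \<times> 'a \<times> 'a) set" where
  "triangles E = {(x, y, z). (x, y) \<in> E \<and> (y, z) \<in> E \<and> (x, z) \<in> E}"

text \<open>Arcs that meet a small part, or join parts of low density or a bad pair, are deleted.
  One surviving triangle lies in three parts to which the counting lemma applies, and then there are
  more triangles than allowed.\<close>

theorem triangle_removal:
  assumes \<epsilon>: "0 < (\<epsilon> :: real)"
  obtains \<delta> :: real where "0 < \<delta>"
    "\<And>V (E :: ('a \<times> 'a) set). finite V \<Longrightarrow> E \<subseteq> V \<times> V \<Longrightarrow> sym E \<Longrightarrow> card (triangles E) \<le> \<delta> * (real (card V)) ^ 3 \<Longrightarrow>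
      \<exists>D\<subseteq>E. sym D \<and> card D \<le> \<epsilon> * (real (card V))\<^sup>2 \<and> triangles (E - D) = {}"
proof -
  \<comment> \<open>Small parts, low density and bad pairs cost e, 2 e and e times n^2, which
    symmetrising doubles to 8 e; the counting lemma needs 1/4.\<close>
  define e where "e = min (\<epsilon> / 8) (1 / 4)"
  have e: "0 < e" "e \<le> 1 / 4" "8 * e \<le> \<epsilon>" using \<epsilon> by (auto simp: e_def)
  obtain K where K: "\<And>V (E :: ('a \<times> 'a) set). finite V \<Longrightarrow>
     \<exists>p. p ` V \<subseteq> {..<K} \<and> card (bad_pairs e E V p) \<le> e * (real (card V))\<^sup>2"
    using regular_partition[OF e(1)] by blast
  \<comment> \<open>At most \<open>K\<close> parts of size below s n contain at most K s n \<le> e n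
    vertices in total; \<open>K + 1\<close> avoids division by zero.\<close>
  define s where "s = e / (K + 1)"
  have s: "0 < s" "K * s \<le> e" using e by (auto simp: s_def divide_simps)
  show ?thesis
  \<comment> \<open>Half of the number of triangles guaranteed in three good parts, so a single
    survivor already gives a contradiction.\<close>
  proof (rule that[of "e ^ 3 / 4 * s ^ 3"])
    show "0 < e ^ 3 / 4 * s ^ 3" using e s by simp
    fix V and E :: "('a \<times> 'a) set"
    assume V: "finite V" and EV: "E \<subseteq> V \<times> V" and "sym E"
      and few: "card (triangles E) \<le> e ^ 3 / 4 * s ^ 3 * (real (card V)) ^ 3"
    obtain p where p: "p ` V \<subseteq> {..<K}" "card (bad_pairs e E V p) \<le> e * (real (card V))\<^sup>2"
      using K[OF V] by blast
    let ?n = "real (card V)"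
    define C where "C i = {v\<in>V. p v = i}" for i
    define small where "small = {x\<in>V. card (C (p x)) < s * ?n}"
    define low where "low = {(x, y) \<in> V \<times> V. dens E (C (p x)) (C (p y)) < 2 * e}"
    define S where "S = E \<inter> (small \<times> V \<union> low \<union> bad_pairs e E V p)"
    \<comment> \<open>\<open>S\<close> handles only arcs whose first end lies in a small part; the
      converse adds those whose second end does.\<close>
    define D where "D = S \<union> S\<inverse>"
    have finC: "finite (C i)" for i using V by (simp add: C_def)
    have finE: "finite E" using EV V by (meson finite_SigmaI finite_subset)
    have csmall: "card small \<le> e * ?n"
    proof -
      let ?I = "{i\<in>{..<K}. card (C i) < s * ?n}"
      have "small \<subseteq> (\<Union>i\<in>?I. C i)" using p by (auto simp: small_def C_def)
      then have "card small \<le> card (\<Union>i\<in>?I. C i)" using finC by (intro card_mono) auto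
      also have "\<dots> \<le> (\<Sum>i\<in>?I. card (C i))" by (rule card_UN_le) simp
      finally have "real (card small) \<le> (\<Sum>i\<in>?I. real (card (C i)))"
        by (metis of_nat_mono of_nat_sum)
      also have "\<dots> \<le> (\<Sum>i\<in>?I. s * ?n)" by (intro sum_mono) auto
      also have "\<dots> = card ?I * (s * ?n)" by simp
      also have "\<dots> \<le> K * (s * ?n)"
        using s card_mono[of "{..<K}" ?I] by (intro mult_right_mono) auto
      also have "\<dots> \<le> e * ?n" using s mult_right_mono[of "K * s" e ?n] by (simp add: mult_ac)
      finally show ?thesis .
    qed
    have clow: "card (E \<inter> low) \<le> 2 * e * ?n\<^sup>2"
    proof -
      let ?O = "V \<times> V" and ?P = "map_prod p p" and ?f = "indicator E :: 'a \<times> 'a \<Rightarrow> real"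
      have finO: "finite ?O" using V by simp
      have lowO: "low \<subseteq> ?O" by (auto simp: low_def)
      \<comment> \<open>\<open>low\<close> is a union of cells of the product partition, so the arcs
        in it can be counted by summing cell densities, all below 2 e.\<close>
      have "(\<Sum>w\<in>?O. indicator low w * avg ?O ?P ?f w) = (\<Sum>w\<in>?O. indicator low w * ?f w)"
        by (rule sum_avg[OF finO]) (auto simp: low_def indicator_def)
      then have "(\<Sum>w\<in>low. avg ?O ?P ?f w) = (\<Sum>w\<in>low. ?f w)"
        unfolding sum_indicator_mult[OF finO] using lowO by (simp add: Int_absorb1)
      also have "\<dots> = card (E \<inter> low)"
        using sum_mult_indicator[OF finite_subset[OF lowO finO], of "\<lambda>_. 1::real" E] by (simp add: Int_commute)
      finally have "card (E \<inter> low) = (\<Sum>w\<in>low. avg ?O ?P ?f w)" ..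
      also have "\<dots> \<le> (\<Sum>w\<in>low. 2 * e)"
        using avg_dens[OF V, of _ _ p E] by (intro sum_mono) (auto simp: low_def C_def less_imp_le)
      also have "\<dots> \<le> card ?O * (2 * e)"
        using card_mono[OF finO lowO] e by simp
      finally show ?thesis by (simp add: card_cartesian_product power2_eq_square mult_ac)
    qed
    have sub: "S \<subseteq> small \<times> V \<union> (E \<inter> low) \<union> bad_pairs e E V p" by (auto simp: S_def)
    have "small \<subseteq> V" "bad_pairs e E V p \<subseteq> V \<times> V" by (auto simp: small_def bad_pairs_def)
    then have "finite (small \<times> V \<union> (E \<inter> low) \<union> bad_pairs e E V p)"
      using V finE by (meson finite_Int finite_SigmaI finite_Un finite_subset)
    then have "card S \<le> card (small \<times> V \<union> (E \<inter> low) \<union> bad_pairs e E V p)"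
      using sub by (rule card_mono)
    also have "\<dots> \<le> card (small \<times> V) + card (E \<inter> low) + card (bad_pairs e E V p)"
      by (meson add_right_mono card_Un_le order_trans)
    finally have "real (card S) \<le> card (small \<times> V) + real (card (E \<inter> low)) + card (bad_pairs e E V p)"
      by linarith
    moreover have "real (card (small \<times> V)) \<le> e * ?n\<^sup>2"
      using mult_right_mono[OF csmall, of ?n] by (simp add: card_cartesian_product power2_eq_square mult_ac)
    ultimately have cS: "card S \<le> 4 * e * ?n\<^sup>2" using clow p(2) by linarith
    have "real (card D) \<le> real (card S) + card (S\<inverse>)"
      unfolding D_def using card_Un_le[of S "S\<inverse>"] by linarith
    also have "\<dots> \<le> 8 * e * ?n\<^sup>2"
      using cS card_inverse[of S] by linarith
    also have "\<dots> \<le> \<epsilon> * ?n\<^sup>2" using e by (intro mult_right_mono) auto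
    finally have cD: "card D \<le> \<epsilon> * ?n\<^sup>2" .
    have "triangles (E - D) = {}"
    proof (rule ccontr)
      assume "triangles (E - D) \<noteq> {}"
      then obtain x y z where xyz: "(x, y) \<in> E - D" "(y, z) \<in> E - D" "(x, z) \<in> E - D"
        by (auto simp: triangles_def)
      then have inV: "x \<in> V" "y \<in> V" "z \<in> V" using EV by auto
      have good: "2 * e \<le> dens E (C (p u)) (C (p v))" "\<not> bad e E (C (p u)) (C (p v))"
        "s * ?n \<le> card (C (p u))" "s * ?n \<le> card (C (p v))"
        if uv: "(u, v) \<in> E - D" for u v
      proof -
        have in_V: "u \<in> V" "v \<in> V" using uv EV by auto
        have nS: "(u, v) \<notin> S" "(v, u) \<notin> S" and E: "(u, v) \<in> E" "(v, u) \<in> E"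
          using uv \<open>sym E\<close> by (auto simp: D_def sym_def)
        then have nin: "(u, v) \<notin> low" "(u, v) \<notin> bad_pairs e E V p" "u \<notin> small" "v \<notin> small"
          using in_V unfolding S_def by blast+
        then show "2 * e \<le> dens E (C (p u)) (C (p v))" "\<not> bad e E (C (p u)) (C (p v))"
          "s * ?n \<le> card (C (p u))" "s * ?n \<le> card (C (p v))"
          using in_V unfolding low_def bad_pairs_def small_def C_def by (simp_all add: not_less)
      qed
      let ?T = "{(x', y', z') \<in> C (p x) \<times> C (p y) \<times> C (p z). (x', y') \<in> E \<and> (y', z') \<in> E \<and> (x', z') \<in> E}"
      have n: "0 < ?n" using inV V by (auto simp: card_gt_0_iff)
      have "e ^ 3 / 2 * s ^ 3 * ?n ^ 3 = e ^ 3 / 2 * ((s * ?n) * (s * ?n) * (s * ?n))"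
        by (simp add: power3_eq_cube)
      also have "\<dots> \<le> e ^ 3 / 2 * (real (card (C (p x))) * card (C (p y)) * card (C (p z)))"
        using good(3,4)[OF xyz(1)] good(4)[OF xyz(2)] e(1) s(1)
        by (intro mult_left_mono mult_mono) simp_all
      also have "\<dots> = e ^ 3 / 2 * card (C (p x)) * card (C (p y)) * card (C (p z))" by simp
      also have "\<dots> \<le> card ?T"
        by (rule triangle_counting[OF finC finC finC e(1,2) good(1,2)[OF xyz(1)]
          good(1,2)[OF xyz(3)] good(1,2)[OF xyz(2)]])
      also have "\<dots> \<le> card (triangles E)"
      proof (intro of_nat_mono card_mono)
        have "triangles E \<subseteq> V \<times> V \<times> V" using EV by (auto simp: triangles_def)
        then show "finite (triangles E)" by (rule finite_subset) (simp add: V)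
      qed (auto simp: triangles_def)
      finally have "e ^ 3 / 2 * s ^ 3 * ?n ^ 3 \<le> e ^ 3 / 4 * s ^ 3 * ?n ^ 3" using few by linarith
      moreover have "0 < e ^ 3 * s ^ 3 * ?n ^ 3" using e s n by simp
      ultimately show False by simp
    qed
    moreover have "D \<subseteq> E" using \<open>sym E\<close> by (auto simp: D_def S_def sym_def)
    moreover have "sym D" by (auto simp: D_def sym_def)
    ultimately show "\<exists>D\<subseteq>E. sym D \<and> card D \<le> \<epsilon> * ?n\<^sup>2 \<and> triangles (E - D) = {}"
      using cD by blast
  qed
qed

section \<open>Mantel's theorem\<close>

text \<open>Adjacent vertices have disjoint neighbourhoods, so their degrees add up to at most n.
  Summing over arcs bounds the sum of squared degrees, and Cauchy-Schwarz finishes. \<open>E\<close>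
  contains both orientations, hence n^2 / 2 in place of n^2 / 4.\<close>

lemma mantel:
  assumes fin: "finite V" and EV: "E \<subseteq> V \<times> V" and "sym E" and tf: "triangles E = {}"
  shows "2 * real (card E) \<le> (real (card V))\<^sup>2"
proof -
  define N where "N x = {y. (x, y) \<in> E}" for x
  let ?n = "real (card V)"
  have NV: "N x \<subseteq> V" for x using EV by (auto simp: N_def)
  have finN: "finite (N x)" for x using NV fin by (rule finite_subset)
  have E: "E = Sigma V N" using EV by (auto simp: N_def)
  have m: "real (card E) = (\<Sum>x\<in>V. real (card (N x)))"
    unfolding E using fin finN by simp
  have swap: "(\<Sum>x\<in>V. \<Sum>y\<in>N x. real (card (N y))) = (\<Sum>x\<in>V. \<Sum>y\<in>N x. real (card (N x)))"
  proof -
    have "(\<Sum>x\<in>V. \<Sum>y\<in>N x. real (card (N y))) = (\<Sum>(x, y)\<in>E. real (card (N y)))"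
      unfolding E using fin finN by (simp add: sum.Sigma del: sum_constant)
    also have "\<dots> = (\<Sum>(x, y)\<in>E. real (card (N x)))"
      using \<open>sym E\<close> by (intro sum.reindex_bij_witness[of _ prod.swap prod.swap]) (auto simp: sym_def)
    also have "\<dots> = (\<Sum>x\<in>V. \<Sum>y\<in>N x. real (card (N x)))"
      unfolding E using fin finN by (simp add: sum.Sigma del: sum_constant)
    finally show ?thesis .
  qed
  have deg: "real (card (N x)) + card (N y) \<le> ?n" if "y \<in> N x" for x y
  proof -
    have "N x \<inter> N y = {}" using that tf by (auto simp: N_def triangles_def)
    then have "card (N x) + card (N y) = card (N x \<union> N y)" using finN by (simp add: card_Un_disjoint)
    also have "\<dots> \<le> card V" using NV fin by (intro card_mono) auto
    finally show ?thesis by linarith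
  qed
  have "2 * (\<Sum>x\<in>V. (real (card (N x)))\<^sup>2) = (\<Sum>x\<in>V. \<Sum>y\<in>N x. real (card (N x)) + card (N y))"
    by (simp add: sum.distrib swap power2_eq_square del: sum_constant) (simp add: power2_eq_square)
  also have "\<dots> \<le> (\<Sum>x\<in>V. \<Sum>y\<in>N x. ?n)" using deg by (intro sum_mono) auto
  also have "\<dots> = ?n * card E" by (simp add: m sum_distrib_left mult_ac)
  finally have "2 * (\<Sum>x\<in>V. (real (card (N x)))\<^sup>2) \<le> ?n * card E" .
  moreover have "(real (card E))\<^sup>2 \<le> ?n * (\<Sum>x\<in>V. (real (card (N x)))\<^sup>2)"
    unfolding m using sum_square_le_card_mult[OF fin, of "\<lambda>x. real (card (N x))"] .
  ultimately have "2 * (real (card E))\<^sup>2 \<le> ?n * (?n * card E)"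
    using mult_left_mono[of "2 * (\<Sum>x\<in>V. (real (card (N x)))\<^sup>2)" "?n * card E" ?n] by simp
  then have "(2 * real (card E)) * card E \<le> ?n\<^sup>2 * card E" by (simp add: power2_eq_square mult_ac)
  then show ?thesis by (cases "card E = 0") (auto simp: mult_le_cancel_right)
qed

section \<open>Copies of books\<close>

text \<open>A book with spine \<open>{u, v}\<close> and page set \<open>W\<close>. This explicit
  form replaces isomorphisms later; \<open>u \<noteq> v\<close> and \<open>u, v \<notin> W\<close>
  are assumed where a genuine book is meant.\<close>

definition book_on :: "'a \<Rightarrow> 'a \<Rightarrow> 'a set \<Rightarrow> 'a graph" where
  "book_on u v W = ({u, v} \<union> W, insert {u, v} (\<Union>w\<in>W. {{u, w}, {v, w}}))"

lemma book_eq_book_on: "book t = book_on 0 1 {2..<t + 2}"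
  by (auto simp: book_def book_on_def)

lemma book_on_edge_iff:
  "{a, b} \<in> edges (book_on u v W) \<longleftrightarrow>
     {a, b} = {u, v} \<or> a \<in> {u, v} \<and> b \<in> W \<or> b \<in> {u, v} \<and> a \<in> W"
  by (auto simp: book_on_def doubleton_eq_iff)

lemma book_on_edge_cases:
  assumes "e \<in> edges (book_on u v W)"
  shows "e = {u, v} \<or> (\<exists>w\<in>W. e = {u, w}) \<or> (\<exists>w\<in>W. e = {v, w})"
  using assms by (auto simp: book_on_def)

lemma simple_graph_book_on:
  assumes "u \<noteq> v" "u \<notin> W" "v \<notin> W" "finite W"
  shows "simple_graph (book_on u v W)"
  using assms by (auto simp: simple_graph_def book_on_def card_insert_if)

lemma isomorphic_book_on:
  assumes uv: "u \<noteq> v" "u \<notin> W" "v \<notin> W" "finite W" and W: "card W = t"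
  shows "isomorphic (book_on u v W) (book t)"
proof -
  obtain h where h: "bij_betw h W {2..<t + 2}"
    using W uv(4) by (metis card_atLeastLessThan diff_add_inverse2 finite_atLeastLessThan finite_same_card_bij)
  define f where "f x = (if x = u then 0 else if x = v then 1 else h x)" for x
  have f: "f u = 0" "f v = 1" "\<And>w. w \<in> W \<Longrightarrow> f w = h w" using uv by (auto simp: f_def)
  have hW: "\<And>w. w \<in> W \<Longrightarrow> 2 \<le> h w \<and> h w < t + 2" using bij_betwE[OF h] by auto
  have inj: "\<And>w w'. w \<in> W \<Longrightarrow> w' \<in> W \<Longrightarrow> h w = h w' \<longleftrightarrow> w = w'"
    using inj_on_eq_iff[OF bij_betw_imp_inj_on[OF h]] by blast
  have "bij_betw f W {2..<t + 2}" using h by (rule bij_betw_cong[THEN iffD1, rotated]) (simp add: f)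
  moreover have "bij_betw f {u, v} {0, 1}" using uv f by (auto simp: bij_betw_def)
  ultimately have "bij_betw f ({u, v} \<union> W) ({0, 1} \<union> {2..<t + 2})"
    by (intro bij_betw_combine) auto
  then have 1: "bij_betw f (verts (book_on u v W)) (verts (book t))"
    by (simp add: book_on_def book_eq_book_on)
  show ?thesis
    unfolding isomorphic_def
  proof (intro exI[of _ f] conjI 1 ballI)
    fix a b assume "a \<in> verts (book_on u v W)" "b \<in> verts (book_on u v W)"
    then have ab: "a = u \<or> a = v \<or> a \<in> W" "b = u \<or> b = v \<or> b \<in> W" by (auto simp: book_on_def)
    have c: "(x = u \<longleftrightarrow> f x = 0) \<and> (x = v \<longleftrightarrow> f x = 1) \<and> (x \<in> W \<longleftrightarrow> f x \<in> {2..<t + 2})"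
      if "x = u \<or> x = v \<or> x \<in> W" for x
    proof -
      from that consider "x = u" | "x = v" | "x \<in> W" by blast
      then show ?thesis
      proof cases
        case 3
        then have "x \<noteq> u" "x \<noteq> v" using uv by auto
        then show ?thesis using hW[OF 3] f(3)[OF 3] 3 by simp
      qed (use uv f(1,2) in auto)
    qed
    show "{a, b} \<in> edges (book_on u v W) \<longleftrightarrow> {f a, f b} \<in> edges (book t)"
      unfolding book_eq_book_on book_on_edge_iff doubleton_eq_iff insert_iff empty_iff
      by (simp add: c[OF ab(1)] c[OF ab(2)])
  qed
qed

text \<open>The inverse isomorphism carries spine and pages of \<open>book t\<close> into the
  copy.\<close>

lemma copies_bookE:
  assumes C: "C \<in> copies (book t) G"
  obtains u v W where "u \<noteq> v" "u \<notin> W" "v \<notin> W" "finite W" "card W = t" "C = book_on u v W"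
proof -
  have simple: "simple_graph C" using C by (auto simp: copies_def subgraph_def)
  obtain f where f: "bij_betw f (verts C) (verts (book t))"
    and fE: "\<And>a b. a \<in> verts C \<Longrightarrow> b \<in> verts C \<Longrightarrow> {a, b} \<in> edges C \<longleftrightarrow> {f a, f b} \<in> edges (book t)"
    using C unfolding copies_def isomorphic_def by blast
  define g where "g = inv_into (verts C) f"
  have g: "bij_betw g (verts (book t)) (verts C)" unfolding g_def by (rule bij_betw_inv_into[OF f])
  have gf: "g (f a) = a" if "a \<in> verts C" for a
    using that f by (auto simp: g_def bij_betw_def)
  have fg: "f (g i) = i" if "i \<in> verts (book t)" for i
    using that f by (auto simp: g_def bij_betw_def f_inv_into_f)
  let ?u = "g 0" and ?v = "g 1" and ?W = "g ` {2..<t + 2}"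
  have vb: "verts (book t) = {0, 1} \<union> {2..<t + 2}" by (simp add: book_eq_book_on book_on_def)
  have inj: "inj_on g (verts (book t))" using g by (simp add: bij_betw_def)
  have vC: "verts C = {?u, ?v} \<union> ?W"
    using bij_betw_imp_surj_on[OF g] unfolding vb by (simp add: image_Un)
  have gg: "g i = g j \<longleftrightarrow> i = j" if "i \<in> verts (book t)" "j \<in> verts (book t)" for i j
    using that inj by (simp add: inj_on_eq_iff)
  have eq: "x = ?u \<longleftrightarrow> f x = 0" "x = ?v \<longleftrightarrow> f x = 1" "x \<in> ?W \<longleftrightarrow> f x \<in> {2..<t + 2}" if x: "x \<in> verts C" for x
  proof -
    have f01: "f ?u = 0" "f ?v = 1" using fg[of 0] fg[of 1] by (simp_all add: vb)
    have "x = ?u" if "f x = 0" using gf[OF x] that by simp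
    then show "x = ?u \<longleftrightarrow> f x = 0" using f01 by blast
    have "x = ?v" if "f x = 1" using gf[OF x] that by simp
    then show "x = ?v \<longleftrightarrow> f x = 1" using f01 by blast
    show "x \<in> ?W \<longleftrightarrow> f x \<in> {2..<t + 2}"
    proof
      assume "x \<in> ?W"
      then obtain i where i: "i \<in> {2..<t + 2}" "x = g i" by blast
      then have "f x = i" using fg[of i] unfolding vb by blast
      then show "f x \<in> {2..<t + 2}" using i by simp
    next
      assume "f x \<in> {2..<t + 2}"
      then show "x \<in> ?W" using imageI[of "f x" _ g] gf[OF x] by simp
    qed
  qed
  have ab: "{a, b} \<in> edges C \<longleftrightarrow> {a, b} \<in> edges (book_on ?u ?v ?W)" if "a \<in> verts C" "b \<in> verts C" for a b
    unfolding fE[OF that] book_eq_book_on book_on_edge_iff doubleton_eq_iff insert_iff empty_iff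
    by (simp only: eq[OF that(1)] eq[OF that(2)])
  \<comment> \<open>An isomorphism controls only edges written as pairs of vertices; simplicity of
    \<open>C\<close> ensures that all its edges are of this kind.\<close>
  have p: "\<exists>a\<in>verts C. \<exists>b\<in>verts C. e = {a, b}" if "e \<in> edges C" for e
  proof -
    have "e \<subseteq> verts C" "card e = 2" using that simple by (auto simp: simple_graph_def)
    then show ?thesis by (auto simp: card_2_iff)
  qed
  have q: "\<exists>a\<in>verts C. \<exists>b\<in>verts C. e = {a, b}" if "e \<in> edges (book_on ?u ?v ?W)" for e
    using book_on_edge_cases[OF that] vC by blast
  have "edges C = edges (book_on ?u ?v ?W)"
  proof (rule set_eqI)
    fix e
    show "e \<in> edges C \<longleftrightarrow> e \<in> edges (book_on ?u ?v ?W)"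
    proof
      assume e: "e \<in> edges C"
      obtain a b where "a \<in> verts C" "b \<in> verts C" "e = {a, b}" using p[OF e] by blast
      then show "e \<in> edges (book_on ?u ?v ?W)" using ab e by simp
    next
      assume e: "e \<in> edges (book_on ?u ?v ?W)"
      obtain a b where "a \<in> verts C" "b \<in> verts C" "e = {a, b}" using q[OF e] by blast
      then show "e \<in> edges C" using ab e by simp
    qed
  qed
  moreover have "verts C = verts (book_on ?u ?v ?W)" using vC by (simp add: book_on_def)
  ultimately have CB: "C = book_on ?u ?v ?W" by (simp add: prod_eq_iff)
  show ?thesis
  proof (rule that[OF _ _ _ _ _ CB])
    show "?u \<noteq> ?v" using gg[of 0 1] vb by simp
    have "g i \<noteq> g j" if "i \<in> {0, 1}" "j \<in> {2..<t + 2}" for i j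
      using gg[of i j] that unfolding vb by auto
    then show "?u \<notin> ?W" "?v \<notin> ?W" by blast+
    have "inj_on g {2..<t + 2}" using inj by (rule inj_on_subset) (unfold vb, rule Un_upper2)
    then show "card ?W = t" by (simp add: card_image)
  qed simp
qed

lemma book_on_in_copies:
  assumes "u \<noteq> v" "u \<notin> W" "v \<notin> W" "finite W" "card W = t"
    and "{u, v} \<union> W \<subseteq> verts G" "edges (book_on u v W) \<subseteq> edges G"
  shows "book_on u v W \<in> copies (book t) G"
proof -
  have "verts (book_on u v W) = {u, v} \<union> W" by (simp add: book_on_def)
  then show ?thesis
    using assms simple_graph_book_on[of u v W] isomorphic_book_on[of u v W t]
    by (simp add: copies_def subgraph_def)
qed

section \<open>The upper bound\<close>

locale rainbow_free_family =
  fixes G :: "'a graph" and \<H> :: "'a graph set" and r t :: nat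
  assumes G: "simple_graph G" and \<H>: "\<H> \<subseteq> copies (book t) G"
    and no_rainbow: "\<And>C. C \<in> copies (book r) G \<Longrightarrow> \<not> rainbow \<H> C"
begin

definition covered :: "'a set set" where "covered = (\<Union>C\<in>\<H>. edges C)"

text \<open>The colours available to \<open>e\<close> in a rainbow subgraph; private edges are those
  with a singleton here.\<close>

definition owners :: "'a set \<Rightarrow> 'a graph set" where "owners e = {C\<in>\<H>. e \<in> edges C}"

text \<open>The last argument is the apex and the edge \<open>{x, y}\<close> is not inspected, so a
  triangle can be tied in three ways.\<close>

definition tied :: "'a \<Rightarrow> 'a \<Rightarrow> 'a \<Rightarrow> bool" where
  "tied x y z \<longleftrightarrow> (\<exists>C. owners {x, z} = {C} \<and> owners {y, z} = {C})"

definition free_pages :: "'a \<Rightarrow> 'a \<Rightarrow> 'a set" where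
  "free_pages x y = {z. {x, z} \<in> covered \<and> {y, z} \<in> covered \<and> \<not> tied x y z}"

definition arcs :: "('a \<times> 'a) set" where "arcs = {(x, y). {x, y} \<in> covered}"

text \<open>All three apexes are excluded, so whichever edge of the triangle is deleted, the
  opposite vertex is a free page of that edge.\<close>

definition free_triangles :: "('a \<times> 'a \<times> 'a) set" where
  "free_triangles = {(x, y, z) \<in> triangles arcs. \<not> tied x y z \<and> \<not> tied y z x \<and> \<not> tied x z y}"

text \<open>Choosing \<open>r\<close> pages greedily uses at most \<open>2 * r + 1\<close> colours,
  that of the spine included, and each colour forbids its \<open>t + 2\<close> vertices.\<close>

definition page_bound :: nat where "page_bound = (t + 2) * (2 * r + 1)"

lemma finV: "finite (verts G)" using G by (simp add: simple_graph_def)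

lemma memberE:
  assumes "C \<in> \<H>"
  obtains u v W where "u \<noteq> v" "u \<notin> W" "v \<notin> W" "finite W" "card W = t" "C = book_on u v W"
  using assms \<H> copies_bookE by blast

lemma member_subgraph:
  assumes "C \<in> \<H>"
  shows "simple_graph C" "verts C \<subseteq> verts G" "edges C \<subseteq> edges G"
  using assms \<H> by (auto simp: copies_def subgraph_def)

lemma card_verts_member:
  assumes "C \<in> \<H>"
  shows "card (verts C) = t + 2"
proof -
  obtain u v W where "u \<noteq> v" "u \<notin> W" "v \<notin> W" "finite W" "card W = t" "C = book_on u v W"
    using assms by (rule memberE)
  then show ?thesis by (simp add: book_on_def)
qed

lemma finite_verts_member: "C \<in> \<H> \<Longrightarrow> finite (verts C)"
  using member_subgraph(2) finV finite_subset by blast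

lemma member_edge:
  assumes "C \<in> \<H>" "{x, y} \<in> edges C"
  shows "x \<in> verts C" "y \<in> verts C" "x \<noteq> y"
  using member_subgraph(1)[OF assms(1)] assms(2) by (auto simp: simple_graph_def)

lemma covered_edge:
  assumes "{x, y} \<in> covered"
  shows "x \<in> verts G" "y \<in> verts G" "x \<noteq> y"
proof -
  obtain C where "C \<in> \<H>" "{x, y} \<in> edges C" using assms by (auto simp: covered_def)
  then show "x \<in> verts G" "y \<in> verts G" "x \<noteq> y"
    using member_edge[of C x y] member_subgraph(2)[of C] by auto
qed

lemma covered_subset: "covered \<subseteq> edges G"
  using member_subgraph(3) by (auto simp: covered_def)

lemma finite_edges: "finite (edges G)"
proof (rule finite_subset)
  show "edges G \<subseteq> Pow (verts G)" using G by (auto simp: simple_graph_def)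
qed (simp add: finV)

lemma finite_covered: "finite covered"
  using covered_subset finite_edges by (rule finite_subset)

lemma finite_family: "finite \<H>"
proof (rule finite_subset)
  show "\<H> \<subseteq> Pow (verts G) \<times> Pow (edges G)" using member_subgraph(2,3) by (force simp: mem_Times_iff)
qed (simp add: finV finite_edges)

lemma owners_nonempty: "e \<in> covered \<Longrightarrow> owners e \<noteq> {}"
  unfolding covered_def owners_def by blast

lemma finite_free_pages: "finite (free_pages x y)"
  by (rule finite_subset[OF _ finV]) (auto simp: free_pages_def dest: covered_edge)

text \<open>A page that is not tied has distinctly coloured edges, and every colour meets boundedly many
  pages, so that \<open>r\<close> pages with disjoint colours can be chosen greedily.\<close>

lemma card_free_pages:
  assumes uv: "{u, v} \<in> covered"
  shows "card (free_pages u v) \<le> page_bound"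
proof (rule ccontr)
  let ?Q = "free_pages u v"
  assume "\<not> ?thesis"
  then have big: "page_bound < card ?Q" by simp
  \<comment> \<open>Two nonempty sets without distinct representatives are the same singleton, which
    is what \<open>tied\<close> says.\<close>
  have "\<exists>c d. c \<in> owners {u, z} \<and> d \<in> owners {v, z} \<and> c \<noteq> d" if z: "z \<in> ?Q" for z
  proof (rule ccontr)
    assume no: "\<nexists>c d. c \<in> owners {u, z} \<and> d \<in> owners {v, z} \<and> c \<noteq> d"
    obtain c where c: "c \<in> owners {u, z}" using z owners_nonempty by (fastforce simp: free_pages_def)
    obtain d where d: "d \<in> owners {v, z}" using z owners_nonempty by (fastforce simp: free_pages_def)
    have "owners {v, z} = {c}" "owners {u, z} = {c}" using no c d by blast+
    then have "tied u v z" unfolding tied_def by blast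
    then show False using z by (simp add: free_pages_def)
  qed
  then obtain c d where cd: "\<And>z. z \<in> ?Q \<Longrightarrow> c z \<in> owners {u, z} \<and> d z \<in> owners {v, z} \<and> c z \<noteq> d z"
    by metis
  obtain c0 where c0: "c0 \<in> owners {u, v}" using owners_nonempty[OF uv] by blast
  have mem: "c z \<in> \<H>" "d z \<in> \<H>" "z \<in> verts (c z)" "z \<in> verts (d z)" if "z \<in> ?Q" for z
  proof -
    have e: "c z \<in> \<H>" "{u, z} \<in> edges (c z)" "d z \<in> \<H>" "{v, z} \<in> edges (d z)"
      using cd[OF that] by (simp_all add: owners_def)
    show "c z \<in> \<H>" "d z \<in> \<H>" by (rule e)+
    show "z \<in> verts (c z)" using e(1,2) by (rule member_edge)
    show "z \<in> verts (d z)" using e(3,4) by (rule member_edge)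
  qed
  have "\<exists>W\<subseteq>?Q. card W = j \<and> (\<forall>w\<in>W. c0 \<notin> {c w, d w}) \<and>
      (\<forall>w\<in>W. \<forall>w'\<in>W. w \<noteq> w' \<longrightarrow> {c w, d w} \<inter> {c w', d w'} = {})" if "j \<le> r" for j
    using that
  proof (induction j)
    case 0
    show ?case by (intro exI[of _ "{}"]) simp
  next
    case (Suc j)
    then obtain W where W: "W \<subseteq> ?Q" "card W = j" "\<forall>w\<in>W. c0 \<notin> {c w, d w}"
      "\<forall>w\<in>W. \<forall>w'\<in>W. w \<noteq> w' \<longrightarrow> {c w, d w} \<inter> {c w', d w'} = {}" by auto
    have finW: "finite W" using W(1) finite_free_pages by (rule finite_subset)
    \<comment> \<open>A vertex outside \<open>?F\<close> lies in no copy used so far, but it lies in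
      \<open>c z\<close> and \<open>d z\<close>; hence both colours are new.\<close>
    let ?F = "verts c0 \<union> (\<Union>w\<in>W. verts (c w) \<union> verts (d w))"
    have c0H: "c0 \<in> \<H>" using c0 by (simp add: owners_def)
    have "card ?F \<le> card (verts c0) + card (\<Union>w\<in>W. verts (c w) \<union> verts (d w))" by (rule card_Un_le)
    also have "\<dots> \<le> (t + 2) + (\<Sum>w\<in>W. card (verts (c w) \<union> verts (d w)))"
      using card_UN_le[OF finW, of "\<lambda>w. verts (c w) \<union> verts (d w)"] card_verts_member[OF c0H] by simp
    also have "(\<Sum>w\<in>W. card (verts (c w) \<union> verts (d w))) \<le> (\<Sum>w\<in>W. (t + 2) + (t + 2))"
    proof (rule sum_mono)
      fix w assume "w \<in> W"
      then have "card (verts (c w)) = t + 2" "card (verts (d w)) = t + 2"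
        using mem(1,2)[of w] W(1) by (simp_all add: card_verts_member subset_iff)
      then show "card (verts (c w) \<union> verts (d w)) \<le> (t + 2) + (t + 2)"
        using card_Un_le[of "verts (c w)" "verts (d w)"] by simp
    qed
    also have "(t + 2) + (\<Sum>w\<in>W. (t + 2) + (t + 2)) = (t + 2) * (2 * j + 1)"
      using W(2) by (simp add: algebra_simps)
    also have "\<dots> \<le> page_bound" unfolding page_bound_def using Suc.prems by (intro mult_le_mono2) simp
    also have "\<dots> < card ?Q" by (rule big)
    finally have less: "card ?F < card ?Q" by simp
    have "finite ?F"
      using finW finite_verts_member[OF c0H] finite_verts_member[OF mem(1)] finite_verts_member[OF mem(2)] W(1)
      by (simp add: subset_iff)
    then have "\<not> ?Q \<subseteq> ?F" using less card_mono[of ?F ?Q] by auto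
    then obtain z where z: "z \<in> ?Q" "z \<notin> ?F" by blast
    have zW: "z \<notin> W" using z mem W(1) by blast
    have "z \<notin> verts c0" "\<And>w. w \<in> W \<Longrightarrow> z \<notin> verts (c w) \<and> z \<notin> verts (d w)"
      using z(2) by blast+
    note nz = this mem(3,4)[OF z(1)]
    have "c0 \<noteq> c z" using nz(1,3) by auto
    moreover have "c0 \<noteq> d z" using nz(1,4) by auto
    ultimately have "c0 \<notin> {c z, d z}" by simp
    moreover have "{c w, d w} \<inter> {c z, d z} = {}" if "w \<in> W" for w
      using nz(2)[OF that] nz(3,4) by fastforce
    ultimately have "(\<forall>w\<in>insert z W. c0 \<notin> {c w, d w}) \<and>
        (\<forall>w\<in>insert z W. \<forall>w'\<in>insert z W. w \<noteq> w' \<longrightarrow> {c w, d w} \<inter> {c w', d w'} = {})"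
      using W(3,4) by blast
    moreover have "insert z W \<subseteq> ?Q" "card (insert z W) = Suc j"
      using W(1,2) z(1) zW finW by simp_all
    ultimately show ?case by blast
  qed
  then obtain W where W: "W \<subseteq> ?Q" "card W = r" "\<forall>w\<in>W. c0 \<notin> {c w, d w}"
    "\<forall>w\<in>W. \<forall>w'\<in>W. w \<noteq> w' \<longrightarrow> {c w, d w} \<inter> {c w', d w'} = {}" by blast
  have finW: "finite W" using W(1) finite_free_pages by (rule finite_subset)
  have WQ: "{u, w} \<in> covered" "{v, w} \<in> covered" if "w \<in> W" for w
    using that W(1) by (auto simp: free_pages_def)
  have ne: "u \<noteq> v" using covered_edge[OF uv] by simp
  have nW: "w \<noteq> u" "w \<noteq> v" if "w \<in> W" for w
    using covered_edge(3)[OF WQ(1)[OF that]] covered_edge(3)[OF WQ(2)[OF that]] by auto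
  have copy: "book_on u v W \<in> copies (book r) G"
  proof (rule book_on_in_copies)
    show "{u, v} \<union> W \<subseteq> verts G"
      using covered_edge(1,2)[OF uv] covered_edge(2)[OF WQ(1)] by blast
    show "edges (book_on u v W) \<subseteq> edges G"
      using uv WQ covered_subset by (auto simp: book_on_def)
  qed (use ne nW finW W in auto)
  \<comment> \<open>Removing the spine end from a page edge leaves the page, whose colour is
    \<open>c\<close> at \<open>u\<close> and \<open>d\<close> at \<open>v\<close>.\<close>
  define \<phi> where "\<phi> e = (if e = {u, v} then c0 else if u \<in> e then c (the_elem (e - {u}))
      else d (the_elem (e - {v})))" for e
  have phi: "\<phi> {u, v} = c0" "\<And>w. w \<in> W \<Longrightarrow> \<phi> {u, w} = c w" "\<And>w. w \<in> W \<Longrightarrow> \<phi> {v, w} = d w"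
  proof -
    show "\<phi> {u, v} = c0" by (simp add: \<phi>_def)
    fix w assume w: "w \<in> W"
    have "{u, w} - {u} = {w}" "{v, w} - {v} = {w}" using nW[OF w] by auto
    moreover have "{u, w} \<noteq> {u, v}" "{v, w} \<noteq> {u, v}" "u \<notin> {v, w}"
      using nW[OF w] ne by (auto simp: doubleton_eq_iff)
    ultimately show "\<phi> {u, w} = c w" "\<phi> {v, w} = d w" by (simp_all add: \<phi>_def)
  qed
  have cdW: "c w \<in> owners {u, w}" "d w \<in> owners {v, w}" "c w \<noteq> d w" if "w \<in> W" for w
    using cd that W(1) by auto
  have own: "\<phi> e \<in> owners e" if "e \<in> edges (book_on u v W)" for e
    using book_on_edge_cases[OF that] phi c0 cdW by auto
  have disj: "c0 \<noteq> c w" "c0 \<noteq> d w" if "w \<in> W" for w using W(3) that by auto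
  have disj2: "c w \<noteq> d w'" "c w = c w' \<Longrightarrow> w = w'" "d w = d w' \<Longrightarrow> w = w'"
    if "w \<in> W" "w' \<in> W" for w w'
    using W(4) that cdW(3) by (cases "w = w'"; fastforce)+
  have "inj_on \<phi> (edges (book_on u v W))"
  proof (rule inj_onI)
    fix e e' assume e: "e \<in> edges (book_on u v W)" "e' \<in> edges (book_on u v W)" "\<phi> e = \<phi> e'"
    from book_on_edge_cases[OF e(1)] book_on_edge_cases[OF e(2)] e(3) show "e = e'"
      by (elim disjE bexE) (auto simp: phi disj disj[symmetric] disj2(1) disj2(1)[symmetric] dest: disj2(2,3))
  qed
  then have "rainbow \<H> (book_on u v W)"
    unfolding rainbow_def using own by (intro exI[of _ \<phi>]) (auto simp: owners_def)
  with no_rainbow[OF copy] show False ..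
qed

section \<open>Triangles of the covered graph and the size of the family\<close>

lemma arcs_subset: "arcs \<subseteq> verts G \<times> verts G"
  using covered_edge by (auto simp: arcs_def)

lemma finite_arcs: "finite arcs"
  using arcs_subset finV by (meson finite_SigmaI finite_subset)

lemma sym_arcs: "sym arcs"
  by (auto simp: sym_def arcs_def insert_commute)

lemma card_arcs: "card arcs = 2 * card covered"
proof -
  have "card arcs = (\<Sum>e\<in>covered. card {a\<in>arcs. {fst a, snd a} = e})"
  proof -
    have "(\<Sum>a\<in>arcs. 1) = (\<Sum>e\<in>covered. \<Sum>a\<in>{a\<in>arcs. {fst a, snd a} = e}. 1)"
      by (rule sum.group[symmetric, OF finite_arcs finite_covered]) (auto simp: arcs_def)
    then show ?thesis unfolding card_eq_sum .
  qed
  also have "\<dots> = (\<Sum>e\<in>covered. 2)"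
  proof (rule sum.cong[OF refl])
    fix e assume e: "e \<in> covered"
    then have "card e = 2" using covered_subset G by (auto simp: simple_graph_def)
    then obtain x y where xy: "e = {x, y}" "x \<noteq> y" by (auto simp: card_2_iff)
    then have "{a\<in>arcs. {fst a, snd a} = e} = {(x, y), (y, x)}"
      using e by (auto simp: arcs_def doubleton_eq_iff insert_commute)
    then show "card {a\<in>arcs. {fst a, snd a} = e} = 2" using xy by simp
  qed
  finally show ?thesis by simp
qed

text \<open>If \<open>z\<close> is not a tied apex, it is a free page of the arc
  \<open>(x, y)\<close>. If it is, then \<open>{x, z}\<close> has a single owner and
  \<open>y\<close> is one of its \<open>t + 2\<close> vertices. Both cases cost a constant per
  arc.\<close>

lemma card_triangles: "card (triangles arcs) \<le> (page_bound + t + 2) * (card (verts G))\<^sup>2"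
proof -
  let ?V = "verts G"
  define sole where "sole e = the_elem (owners e)" for e
  let ?P = "{a \<in> arcs. owners {fst a, snd a} = {sole {fst a, snd a}}}"
  let ?A = "Sigma arcs (\<lambda>(x, y). free_pages x y)"
  let ?B = "Sigma ?P (\<lambda>(x, z). verts (sole {x, z}))"
  have sub: "triangles arcs \<subseteq> (\<lambda>((x, y), z). (x, y, z)) ` ?A \<union> (\<lambda>((x, z), y). (x, y, z)) ` ?B"
  proof
    fix T assume "T \<in> triangles arcs"
    then obtain x y z where T: "T = (x, y, z)"
      and a: "(x, y) \<in> arcs" "(y, z) \<in> arcs" "(x, z) \<in> arcs"
      by (auto simp: triangles_def)
    show "T \<in> (\<lambda>((x, y), z). (x, y, z)) ` ?A \<union> (\<lambda>((x, z), y). (x, y, z)) ` ?B"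
    proof (cases "tied x y z")
      case True
      then obtain C where C: "owners {x, z} = {C}" "owners {y, z} = {C}" by (auto simp: tied_def)
      then have s: "sole {x, z} = C" by (simp add: sole_def)
      have "C \<in> \<H>" "{y, z} \<in> edges C" using C(2) by (auto simp: owners_def)
      then have "y \<in> verts C" by (rule member_edge)
      then have "((x, z), y) \<in> ?B" using s C a by simp
      from imageI[OF this, of "\<lambda>((x, z), y). (x, y, z)"] show ?thesis unfolding T by simp
    next
      case False
      then have "((x, y), z) \<in> ?A" using a by (simp add: free_pages_def arcs_def)
      from imageI[OF this, of "\<lambda>((x, y), z). (x, y, z)"] show ?thesis unfolding T by simp
    qed
  qed
  have arcsV: "card arcs \<le> (card ?V)\<^sup>2"
    using card_mono[OF _ arcs_subset] finV by (simp add: card_cartesian_product power2_eq_square)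
  have cA: "card ?A \<le> page_bound * (card ?V)\<^sup>2"
  proof -
    have "card ?A = (\<Sum>(x, y)\<in>arcs. card (free_pages x y))"
      using finite_arcs finite_free_pages by (subst card_SigmaI) (auto simp: split_beta)
    also have "\<dots> \<le> (\<Sum>a\<in>arcs. page_bound)"
      using card_free_pages by (intro sum_mono) (auto simp: arcs_def)
    also have "\<dots> = card arcs * page_bound" by simp
    also have "\<dots> \<le> (card ?V)\<^sup>2 * page_bound" using arcsV by (rule mult_le_mono1)
    finally show ?thesis by (simp add: mult.commute)
  qed
  have P: "sole {fst a, snd a} \<in> \<H>" if "a \<in> ?P" for a using that by (auto simp: owners_def)
  have finP: "finite ?P" using finite_arcs by simp
  have cB: "card ?B \<le> (t + 2) * (card ?V)\<^sup>2"
  proof -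
    have "card ?B = (\<Sum>a\<in>?P. card (verts (sole {fst a, snd a})))"
      using finP P finite_verts_member by (subst card_SigmaI) (auto simp: split_beta)
    also have "\<dots> = (\<Sum>a\<in>?P. t + 2)" using P card_verts_member by (intro sum.cong) auto
    also have "\<dots> = card ?P * (t + 2)" by simp
    also have "\<dots> \<le> card arcs * (t + 2)" using finite_arcs by (intro mult_le_mono1 card_mono) auto
    also have "\<dots> \<le> (card ?V)\<^sup>2 * (t + 2)" using arcsV by (rule mult_le_mono1)
    finally show ?thesis by (simp add: mult.commute)
  qed
  have finA: "finite ?A" "finite ?B"
    using finite_arcs finite_free_pages finP finite_verts_member[OF P] by (auto intro!: finite_SigmaI)
  have "card (triangles arcs) \<le> card ((\<lambda>((x, y), z). (x, y, z)) ` ?A \<union> (\<lambda>((x, z), y). (x, y, z)) ` ?B)"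
    using sub finA by (intro card_mono) auto
  also have "\<dots> \<le> card ((\<lambda>((x, y), z). (x, y, z)) ` ?A) + card ((\<lambda>((x, z), y). (x, y, z)) ` ?B)"
    by (rule card_Un_le)
  also have "\<dots> \<le> card ?A + card ?B"
    using finA by (intro add_mono card_image_le)
  finally show ?thesis using cA cB by (simp add: algebra_simps)
qed

text \<open>Each such triangle has an arc in \<open>D\<close>, in one of three positions, and its
  remaining vertex is a free page of that arc.\<close>

lemma card_free_triangles:
  assumes D: "D \<subseteq> arcs" "sym D" "triangles (arcs - D) = {}"
  shows "finite free_triangles" "card free_triangles \<le> 3 * (card D * page_bound)"
proof -
  let ?A = "Sigma D (\<lambda>(x, y). free_pages x y)"
  have finD: "finite D" using D(1) finite_arcs by (rule finite_subset)
  have finA: "finite ?A" using finD finite_free_pages by (auto intro!: finite_SigmaI)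
  have cA: "card ?A \<le> card D * page_bound"
  proof -
    have "card ?A = (\<Sum>(x, y)\<in>D. card (free_pages x y))"
      using finD finite_free_pages by (subst card_SigmaI) (auto simp: split_beta)
    also have "\<dots> \<le> (\<Sum>a\<in>D. page_bound)"
      using card_free_pages D(1) by (intro sum_mono) (auto simp: arcs_def)
    finally show ?thesis by simp
  qed
  let ?f = "\<lambda>((x, y), z). (x, y, z)" and ?g = "\<lambda>((y, z), x). (x, y, z)" and ?h = "\<lambda>((x, z), y). (x, y, z)"
  have sub: "free_triangles \<subseteq> ?f ` ?A \<union> (?g ` ?A \<union> ?h ` ?A)"
  proof
    fix T assume "T \<in> free_triangles"
    then obtain x y z where T: "T = (x, y, z)"
      and a: "(x, y) \<in> arcs" "(y, z) \<in> arcs" "(x, z) \<in> arcs"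
      and nt: "\<not> tied x y z" "\<not> tied y z x" "\<not> tied x z y"
      by (auto simp: free_triangles_def triangles_def)
    have pages: "z \<in> free_pages x y" "x \<in> free_pages y z" "y \<in> free_pages x z"
      using a nt by (simp_all add: free_pages_def arcs_def insert_commute)
    have "(x, y) \<in> D \<or> (y, z) \<in> D \<or> (x, z) \<in> D"
      using D(3) a unfolding triangles_def by blast
    then have "((x, y), z) \<in> ?A \<or> ((y, z), x) \<in> ?A \<or> ((x, z), y) \<in> ?A"
      using pages by simp
    then show "T \<in> ?f ` ?A \<union> (?g ` ?A \<union> ?h ` ?A)"
      using imageI[of "((x, y), z)" ?A ?f] imageI[of "((y, z), x)" ?A ?g] imageI[of "((x, z), y)" ?A ?h]
      unfolding T by auto
  qed
  show "finite free_triangles" by (rule finite_subset[OF sub]) (simp add: finA)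
  have "card free_triangles \<le> card (?f ` ?A \<union> (?g ` ?A \<union> ?h ` ?A))"
    using sub finA by (intro card_mono) auto
  also have "\<dots> \<le> card (?f ` ?A) + (card (?g ` ?A) + card (?h ` ?A))"
    by (meson add_left_mono card_Un_le order_trans)
  also have "\<dots> \<le> card ?A + (card ?A + card ?A)"
    using finA by (intro add_mono card_image_le)
  finally show "card free_triangles \<le> 3 * (card D * page_bound)" using cA by simp
qed

text \<open>Sets of private edges of different copies are disjoint, so at most half as many copies
  as covered edges have two of them. In any other copy no two edges share a sole owner, so each page
  forms a free triangle with the spine.\<close>

lemma card_family:
  assumes t: "1 \<le> t" and D: "D \<subseteq> arcs" "sym D" "triangles (arcs - D) = {}"
  shows "2 * card \<H> \<le> card covered + 2 * (3 * (card D * page_bound) * 2 ^ page_bound)"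
proof -
  define priv where "priv C = {e\<in>covered. owners e = {C}}" for C
  let ?A = "{C\<in>\<H>. 2 \<le> card (priv C)}"
  have finA: "finite ?A" using finite_family by simp
  have fpriv: "finite (priv C)" for C using finite_covered by (simp add: priv_def)
  have "2 * card ?A = (\<Sum>C\<in>?A. 2)" by simp
  also have "\<dots> \<le> (\<Sum>C\<in>?A. card (priv C))" by (intro sum_mono) auto
  also have "\<dots> = card (\<Union>C\<in>?A. priv C)"
    using finA fpriv by (intro card_UN_disjoint[symmetric]) (auto simp: priv_def)
  also have "\<dots> \<le> card covered"
    using finite_covered by (intro card_mono) (auto simp: priv_def)
  finally have A: "2 * card ?A \<le> card covered" .
  \<comment> \<open>An untied copy is determined by its spine and a subset of the free pages of the
    spine, which leaves at most \<open>2 ^ page_bound\<close> copies.\<close>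
  let ?F = "\<lambda>(x, y, z). book_on x y ` Pow (free_pages x y)"
  have B: "\<H> - ?A \<subseteq> (\<Union>T\<in>free_triangles. ?F T)"
  proof
    fix C assume C: "C \<in> \<H> - ?A"
    then obtain u v W where W: "u \<noteq> v" "u \<notin> W" "v \<notin> W" "finite W" "card W = t" "C = book_on u v W"
      using memberE by (metis DiffD1)
    have nopriv: "e = e'" if "e \<in> edges C" "e' \<in> edges C" "owners e = {C'}" "owners e' = {C'}" for e e' C'
    proof (rule ccontr)
      assume "e \<noteq> e'"
      have "C \<in> owners e" using that(1) C by (simp add: owners_def)
      then have "C' = C" using that(3) by simp
      then have "{e, e'} \<subseteq> priv C" using that C by (auto simp: priv_def covered_def)
      then have "card {e, e'} \<le> card (priv C)" using fpriv by (intro card_mono)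
      then show False using C \<open>e \<noteq> e'\<close> by simp
    qed
    have e: "{u, v} \<in> edges C" "\<And>w. w \<in> W \<Longrightarrow> {u, w} \<in> edges C" "\<And>w. w \<in> W \<Longrightarrow> {v, w} \<in> edges C"
      using W(6) by (auto simp: book_on_def)
    have cov: "edges C \<subseteq> covered" using C by (auto simp: covered_def)
    have free: "(u, v, w) \<in> free_triangles" if w: "w \<in> W" for w
    proof -
      have d: "{u, w} \<noteq> {v, w}" "{v, u} \<noteq> {w, u}" "{u, v} \<noteq> {w, v}"
        using W(1-3) w by (auto simp: doubleton_eq_iff)
      have "(u, v, w) \<in> triangles arcs" using e w cov by (auto simp: triangles_def arcs_def)
      moreover have "\<not> tied u v w" unfolding tied_def using nopriv[of "{u, w}" "{v, w}"] d e w by blast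
      moreover have "\<not> tied v w u" unfolding tied_def
        using nopriv[of "{v, u}" "{w, u}"] d e w by (auto simp: insert_commute)
      moreover have "\<not> tied u w v" unfolding tied_def
        using nopriv[of "{u, v}" "{w, v}"] d e w by (auto simp: insert_commute)
      ultimately show ?thesis by (simp add: free_triangles_def)
    qed
    have "W \<subseteq> free_pages u v"
      using free by (auto simp: free_triangles_def triangles_def arcs_def free_pages_def)
    \<comment> \<open>Having a page, by \<open>1 \<le> t\<close>, attaches the copy to at least one
      free triangle.\<close>
    moreover obtain w where "w \<in> W" using W(5) t by fastforce
    ultimately show "C \<in> (\<Union>T\<in>free_triangles. ?F T)"
      using free[of w] W(6) by (intro UN_I[of "(u, v, w)"]) auto
  qed
  have fF: "finite (?F T)" for T using finite_free_pages by (simp add: split_beta)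
  have "card (\<H> - ?A) \<le> card (\<Union>T\<in>free_triangles. ?F T)"
    using B card_free_triangles(1)[OF D] fF by (intro card_mono finite_UN_I)
  also have "\<dots> \<le> (\<Sum>T\<in>free_triangles. card (?F T))"
    by (rule card_UN_le[OF card_free_triangles(1)[OF D]])
  also have "\<dots> \<le> (\<Sum>T\<in>free_triangles. 2 ^ page_bound)"
  proof (intro sum_mono)
    fix T assume T: "T \<in> free_triangles"
    obtain x y z where xyz: "T = (x, y, z)" by (cases T)
    have "{x, y} \<in> covered" using T by (auto simp: xyz free_triangles_def triangles_def arcs_def)
    then have "(2::nat) ^ card (free_pages x y) \<le> 2 ^ page_bound"
      using card_free_pages by (intro power_increasing) auto
    moreover have "card (?F T) \<le> 2 ^ card (free_pages x y)"
      using card_image_le[of "Pow (free_pages x y)" "book_on x y"] finite_free_pages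
      by (simp add: xyz card_Pow)
    ultimately show "card (?F T) \<le> 2 ^ page_bound" by linarith
  qed
  also have "\<dots> = card free_triangles * 2 ^ page_bound" by simp
  also have "\<dots> \<le> 3 * (card D * page_bound) * 2 ^ page_bound"
    using card_free_triangles(2)[OF D] by (rule mult_le_mono1)
  finally have "card (\<H> - ?A) \<le> 3 * (card D * page_bound) * 2 ^ page_bound" .
  moreover have "card \<H> = card ?A + card (\<H> - ?A)"
    using finite_family card_Diff_subset[of ?A \<H>] card_mono[of \<H> ?A] by auto
  ultimately show ?thesis using A by linarith
qed

end

section \<open>Combining removal, Mantel's theorem and the count of copies\<close>

lemma rainbow_free_family_upper:
  assumes \<eta>: "0 < (\<eta> :: real)" and t: "1 \<le> t"
  obtains N where "\<And>(G :: 'a graph) \<H>. rainbow_free_family G \<H> r t \<Longrightarrow> N \<le> card (verts G) \<Longrightarrow>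
    card \<H> \<le> (1 / 8 + \<eta>) * (real (card (verts G)))\<^sup>2"
proof -
  define M where "M = (t + 2) * (2 * r + 1)"
  \<comment> \<open>The cost of one arc of \<open>D\<close>: 1/4 for restoring it after Mantel's
    bound, and the remaining term for the copies without two private edges.\<close>
  define k where "k = 1 / 4 + 3 * real M * 2 ^ M"
  have k: "0 < k" by (simp add: k_def add_pos_nonneg)
  obtain \<delta> :: real where \<delta>: "0 < \<delta>"
    "\<And>V (E :: ('a \<times> 'a) set). finite V \<Longrightarrow> E \<subseteq> V \<times> V \<Longrightarrow> sym E \<Longrightarrow> card (triangles E) \<le> \<delta> * (real (card V)) ^ 3 \<Longrightarrow>
      \<exists>D\<subseteq>E. sym D \<and> card D \<le> \<eta> / k * (real (card V))\<^sup>2 \<and> triangles (E - D) = {}"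
    using triangle_removal[of "\<eta> / k"] \<eta> k by (metis divide_pos_pos)
  show ?thesis
  \<comment> \<open>From this size on, (M + t + 2) n^2 triangles are at most \<delta> n^3.\<close>
  proof (rule that[of "nat \<lceil>(M + t + 2) / \<delta>\<rceil>"])
    fix G :: "'a graph" and \<H> assume "rainbow_free_family G \<H> r t"
      and N: "nat \<lceil>(M + t + 2) / \<delta>\<rceil> \<le> card (verts G)"
    then interpret rainbow_free_family G \<H> r t by simp
    let ?n = "real (card (verts G))"
    have M: "page_bound = M" by (simp add: page_bound_def M_def)
    have "(M + t + 2) / \<delta> \<le> ?n" using N by linarith
    then have "M + t + 2 \<le> \<delta> * ?n" using \<delta>(1) by (simp add: divide_simps mult.commute)
    then have "(M + t + 2) * ?n\<^sup>2 \<le> (\<delta> * ?n) * ?n\<^sup>2" by (intro mult_right_mono) auto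
    moreover have "real (card (triangles arcs)) \<le> (M + t + 2) * ?n\<^sup>2"
      using card_triangles unfolding M by (metis of_nat_mono of_nat_mult of_nat_power)
    ultimately have "card (triangles arcs) \<le> \<delta> * ?n ^ 3" by (simp add: power3_eq_cube power2_eq_square mult_ac)
    from \<delta>(2)[OF finV arcs_subset sym_arcs this] obtain D where
      D: "D \<subseteq> arcs" "sym D" "card D \<le> \<eta> / k * ?n\<^sup>2" "triangles (arcs - D) = {}" by blast
    have "sym (arcs - D)" using D(2) sym_arcs by (auto simp: sym_def)
    then have "2 * real (card (arcs - D)) \<le> ?n\<^sup>2"
      using arcs_subset D(4) by (intro mantel[OF finV]) auto
    moreover have "card arcs = card (arcs - D) + card D"
      using finite_arcs D(1) finite_subset[OF D(1) finite_arcs] card_mono[OF finite_arcs D(1)] by (simp add: card_Diff_subset)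
    ultimately have "4 * real (card covered) \<le> ?n\<^sup>2 + 2 * card D" using card_arcs by linarith
    moreover have "2 * card \<H> \<le> card covered + 2 * (3 * (card D * M) * 2 ^ M)"
      using card_family[OF t D(1,2,4)] unfolding M .
    then have "2 * real (card \<H>) \<le> real (card covered) + 2 * (3 * (real (card D) * M) * 2 ^ M)"
      by (metis (mono_tags, lifting) of_nat_add of_nat_mono of_nat_mult of_nat_numeral of_nat_power)
    ultimately have "real (card \<H>) \<le> ?n\<^sup>2 / 8 + card D * k"
      unfolding k_def by (simp add: algebra_simps)
    also have "\<dots> \<le> ?n\<^sup>2 / 8 + (\<eta> / k * ?n\<^sup>2) * k"
      using D(3) k by (intro add_left_mono mult_right_mono) auto
    also have "\<dots> = (1 / 8 + \<eta>) * ?n\<^sup>2" using k by (simp add: algebra_simps)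
    finally show "card \<H> \<le> (1 / 8 + \<eta>) * ?n\<^sup>2" .
  qed
qed

section \<open>The lower bound\<close>

text \<open>The classes of \<open>div 2\<close> serve as the matching pairs \<open>2 * i\<close>,
  \<open>2 * i + 1\<close>; the lower bound rests on no pair having three members.\<close>

lemma three_same_half:
  fixes a b c :: nat
  assumes "a div 2 = b div 2" "b div 2 = c div 2"
  shows "a = b \<or> b = c \<or> a = c"
proof -
  have "a mod 2 = b mod 2 \<or> b mod 2 = c mod 2 \<or> a mod 2 = c mod 2"
    by (auto simp: mod2_eq_if)
  then show ?thesis
    using assms div_mult_mod_eq[of a 2] div_mult_mod_eq[of b 2] div_mult_mod_eq[of c 2] by metis
qed

text \<open>The first \<open>2 * k\<close> vertices carry a matching of spines, joined completely to the others.  A copy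
  consists of one spine, the fixed pages \<open>2 * k, \<dots>, 2 * k + t - 2\<close> and one further page, and it
  owns both edges of the latter.\<close>

lemma rb_ge:
  assumes "t \<le> r" "2 \<le> t" and k: "2 * k \<le> n"
  shows "k * (n - (2 * k + (t - 1))) \<le> rb n (book t) (book r)"
proof -
  \<comment> \<open>There are only \<open>t - 1 < r\<close> fixed pages, so \<open>r\<close> pages
    on one spine must include a page outside \<open>F\<close>, whose two edges share their only
    possible owner.\<close>
  define F where "F = {2 * k..<2 * k + (t - 1)}"
  define B where "B i b = book_on (2 * i) (2 * i + 1) (insert b F)" for i b
  define P where "P = {..<k} \<times> {2 * k + (t - 1)..<n}"
  define \<H> where "\<H> = (\<lambda>(i, b). B i b) ` P"
  define adj where "adj x y \<longleftrightarrow> x \<noteq> y \<and> x < n \<and> y < n \<and> (x < 2 * k \<or> y < 2 * k) \<and>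
    (x < 2 * k \<longrightarrow> y < 2 * k \<longrightarrow> x div 2 = y div 2)" for x y :: nat
  define G where "G = ({..<n}, {{x, y} | x y. adj x y})"
  have adj_sym: "adj x y \<Longrightarrow> adj y x" for x y by (auto simp: adj_def)
  have G_edge: "{x, y} \<in> edges G \<longleftrightarrow> adj x y" for x y
  proof
    assume "{x, y} \<in> edges G"
    then obtain a b where "adj a b" "x = a \<and> y = b \<or> x = b \<and> y = a"
      by (auto simp: G_def doubleton_eq_iff)
    then show "adj x y" using adj_sym by blast
  qed (auto simp: G_def)
  have G: "simple_graph G" "card (verts G) = n"
    by (auto simp: simple_graph_def G_def adj_def card_insert_if)
  have HG: "\<H> \<subseteq> copies (book t) G"
  proof
    fix C assume "C \<in> \<H>"
    then obtain i b where ib: "i < k" "2 * k + (t - 1) \<le> b" "b < n" "C = B i b" by (auto simp: \<H>_def P_def)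
    show "C \<in> copies (book t) G"
      unfolding ib(4) B_def
    proof (rule book_on_in_copies)
      show "card (insert b F) = t" using ib assms by (simp add: F_def)
      show "{2 * i, 2 * i + 1} \<union> insert b F \<subseteq> verts G" using ib by (auto simp: G_def F_def)
      have "adj (2 * i) (2 * i + 1)" using ib by (auto simp: adj_def)
      moreover have "adj (2 * i) w" "adj (2 * i + 1) w" if "w \<in> insert b F" for w
        using that ib by (auto simp: adj_def F_def)
      ultimately show "edges (book_on (2 * i) (2 * i + 1) (insert b F)) \<subseteq> edges G"
        using G_edge by (auto simp: book_on_def simp del: insert_iff)
    qed (use ib in \<open>auto simp: F_def\<close>)
  qed
  have B_edge: "y div 2 = i" "x = b"
    if e: "{y, x} \<in> edges (B i b)" and b: "i < k" "2 * k + (t - 1) \<le> b"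
      and yx: "y < 2 * k" "2 * k + (t - 1) \<le> x" for i b x y
  proof -
    have F: "w < 2 * k + (t - 1)" "2 * k \<le> w" if "w \<in> F" for w using that by (auto simp: F_def)
    have "x \<notin> {2 * i, 2 * i + 1}" using yx b by auto
    then have "y \<in> {2 * i, 2 * i + 1} \<and> x \<in> insert b F"
      using e unfolding B_def book_on_edge_iff doubleton_eq_iff by blast
    then show "y div 2 = i" "x = b" using F[of x] yx by auto
  qed
  have own: "C = B (y div 2) x"
    if C: "C \<in> \<H>" "{y, x} \<in> edges C" and yx: "y < 2 * k" "2 * k + (t - 1) \<le> x" for C x y
  proof -
    obtain i b where ib: "i < k" "2 * k + (t - 1) \<le> b" "C = B i b" using C by (auto simp: \<H>_def P_def)
    then show ?thesis using B_edge[of y x i b] C(2) yx by simp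
  qed
  have "inj_on (\<lambda>(i, b). B i b) P"
  proof (rule inj_onI, clarify)
    fix i b i' b' assume P: "(i, b) \<in> P" "(i', b') \<in> P" and eq: "B i b = B i' b'"
    have "{2 * i, b} \<in> edges (B i b)" unfolding B_def book_on_edge_iff by simp
    then have "{2 * i, b} \<in> edges (B i' b')" unfolding eq .
    then have "2 * i div 2 = i' \<and> b = b'"
      using B_edge[of "2 * i" b i' b'] P by (simp add: P_def)
    then show "i = i' \<and> b = b'" by simp
  qed
  then have "card \<H> = card P" by (simp add: \<H>_def card_image)
  then have card: "card \<H> = k * (n - (2 * k + (t - 1)))" by (simp add: P_def)
  have "\<not> rainbow \<H> C" if C: "C \<in> copies (book r) G" for C
  proof
    assume "rainbow \<H> C"
    then obtain \<phi> where \<phi>: "inj_on \<phi> (edges C)" "\<And>e. e \<in> edges C \<Longrightarrow> \<phi> e \<in> \<H> \<and> e \<in> edges (\<phi> e)"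
      unfolding rainbow_def by blast
    obtain u v W where W: "u \<noteq> v" "u \<notin> W" "v \<notin> W" "finite W" "card W = r" "C = book_on u v W"
      using C by (rule copies_bookE)
    have "edges C \<subseteq> edges G" using C by (simp add: copies_def subgraph_def)
    moreover have eC: "{u, v} \<in> edges C" "\<And>w. w \<in> W \<Longrightarrow> {u, w} \<in> edges C \<and> {v, w} \<in> edges C"
      unfolding W(6) book_on_edge_iff by auto
    ultimately have "{u, v} \<in> edges G" "\<And>w. w \<in> W \<Longrightarrow> {u, w} \<in> edges G \<and> {v, w} \<in> edges G" by blast+
    then have adj: "adj u v" "\<And>w. w \<in> W \<Longrightarrow> adj u w \<and> adj v w" by (simp_all add: G_edge)
    \<comment> \<open>For a spine joining the two sides: its pages all lie in the matching pair of
      the end below \<open>2 * k\<close>. With at least two pages, that pair would have three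
      members.\<close>
    have half: False if "\<And>w. w \<in> W \<Longrightarrow> w div 2 = x div 2" "x \<notin> W" for x
    proof -
      have "2 \<le> card W" using W(5) assms by simp
      then have "\<not> card W \<le> Suc 0" by simp
      then obtain w w' where "w \<in> W" "w' \<in> W" "w \<noteq> w'"
        unfolding card_le_Suc0_iff_eq[OF W(4)] by blast
      moreover have "w \<noteq> x" "w' \<noteq> x" using calculation that(2) by auto
      ultimately show False using that(1)[of w] that(1)[of w'] three_same_half[of w w' x] by simp
    qed
    consider "u < 2 * k" "v < 2 * k" | "u < 2 * k" "2 * k \<le> v" | "2 * k \<le> u" "v < 2 * k"
      using adj(1) unfolding adj_def by linarith
    then show False
    proof cases
      case 1
      have uv: "u div 2 = v div 2" using adj(1) 1 by (auto simp: adj_def)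
      have "2 * k \<le> w" if "w \<in> W" for w
      proof (rule ccontr)
        assume "\<not> 2 * k \<le> w"
        then have "u div 2 = w div 2" "u \<noteq> w" "v \<noteq> w" using adj(2)[OF that] 1 by (auto simp: adj_def)
        then show False using uv W(1) three_same_half[of u v w] by simp
      qed
      moreover have "\<not> W \<subseteq> F"
      proof
        assume "W \<subseteq> F"
        then have "card W \<le> card F" by (intro card_mono) (simp_all add: F_def)
        then show False using W(5) assms by (simp add: F_def)
      qed
      then obtain w where "w \<in> W" "w \<notin> F" by blast
      ultimately have w: "w \<in> W" "2 * k + (t - 1) \<le> w" by (auto simp: F_def not_less)
      have \<phi>w: "\<phi> {u, w} \<in> \<H> \<and> {u, w} \<in> edges (\<phi> {u, w})" "\<phi> {v, w} \<in> \<H> \<and> {v, w} \<in> edges (\<phi> {v, w})"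
        using \<phi>(2) eC(2)[OF w(1)] by blast+
      have "\<phi> {u, w} = B (u div 2) w" by (rule own) (use \<phi>w(1) 1 w(2) in simp_all)
      moreover have "\<phi> {v, w} = B (v div 2) w" by (rule own) (use \<phi>w(2) 1 w(2) in simp_all)
      ultimately have "\<phi> {u, w} = \<phi> {v, w}" using uv by simp
      then have "{u, w} = {v, w}" using inj_onD[OF \<phi>(1)] eC(2)[OF w(1)] by blast
      then show False using W(1) by (auto simp: doubleton_eq_iff)
    next
      case 2
      have "w div 2 = u div 2" if "w \<in> W" for w
        using adj(2)[OF that] 2 by (auto simp: adj_def)
      then show False using half W(2) by blast
    next
      case 3
      have "w div 2 = v div 2" if "w \<in> W" for w
        using adj(2)[OF that] 3 by (auto simp: adj_def)
      then show False using half W(3) by blast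
    qed
  qed
  then have "card \<H> \<in> rb_cards n (book t) (book r)"
    unfolding rb_cards_def using G HG by (intro CollectI exI[of _ G] exI[of _ \<H>]) simp
  then show ?thesis
    unfolding rb_def card[symmetric] using finite_rb_cards by (rule Max_ge[rotated])
qed

lemma rb_ge_real:
  assumes "t \<le> r" "2 \<le> t" and n: "4 + 2 * t \<le> n"
  shows "(real n / 4 - 1) * (real n / 2 - real t) \<le> rb n (book t) (book r)"
proof -
  \<comment> \<open>k (n - 2 k) is maximal at k = n / 4, with value n^2 / 8; the assumption on
    \<open>n\<close> keeps both lower estimates nonnegative.\<close>
  let ?k = "n div 4"
  have "real n / 4 - 1 \<le> ?k" by linarith
  moreover have "real n / 2 - real t \<le> real (n - (2 * ?k + (t - 1)))" using assms(2) by linarith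
  ultimately have "(real n / 4 - 1) * (real n / 2 - real t) \<le> ?k * real (n - (2 * ?k + (t - 1)))"
    using n by (intro mult_mono) auto
  also have "\<dots> \<le> rb n (book t) (book r)"
  proof -
    have "2 * ?k \<le> n" by linarith
    from of_nat_mono[OF rb_ge[OF assms(1,2) this], where 'a = real] show ?thesis by simp
  qed
  finally show ?thesis .
qed

lemma rb_le:
  assumes \<eta>: "0 < (\<eta> :: real)" and t: "1 \<le> t"
  obtains N where "\<And>n. N \<le> n \<Longrightarrow> rb n (book t) (book r) \<le> (1 / 8 + \<eta>) * (real n)\<^sup>2"
proof -
  obtain N where N: "\<And>(G :: nat graph) \<H>. rainbow_free_family G \<H> r t \<Longrightarrow> N \<le> card (verts G) \<Longrightarrow>
    card \<H> \<le> (1 / 8 + \<eta>) * (real (card (verts G)))\<^sup>2"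
    using rainbow_free_family_upper[OF \<eta> t] by blast
  show ?thesis
  proof (rule that[of N])
    fix n assume n: "N \<le> n"
    have "edges (book r) \<noteq> {}" by (simp add: book_def)
    then have "rb n (book t) (book r) \<in> rb_cards n (book t) (book r)"
      unfolding rb_def by (intro Max_in finite_rb_cards rb_cards_nonempty simple_graph_book)
    then obtain G :: "nat graph" and \<H> where "card \<H> = rb n (book t) (book r)"
      "simple_graph G" "card (verts G) = n" "\<H> \<subseteq> copies (book t) G"
      "\<forall>C\<in>copies (book r) G. \<not> rainbow \<H> C"
      unfolding rb_cards_def by auto
    then show "rb n (book t) (book r) \<le> (1 / 8 + \<eta>) * (real n)\<^sup>2"
      using N[of G \<H>] n by (simp add: rainbow_free_family_def)
  qed
qed

section \<open>The asymptotic value\<close>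

theorem theorem4p8:
  fixes r t :: nat
  assumes "r \<ge> t" and "t \<ge> 2"
  shows "(\<lambda>n. real (rb n (book t) (book r))) \<sim>[at_top] (\<lambda>n. (real n)\<^sup>2 / 8)"
proof (rule asymp_equivI', rule order_tendstoI)
  let ?f = "\<lambda>n. real (rb n (book t) (book r))"
  fix a :: real assume a: "a < 1"
  have "(\<lambda>n. ((real n / 4 - 1) * (real n / 2 - real t)) / ((real n)\<^sup>2 / 8)) \<longlonglongrightarrow> 1"
    by real_asymp
  then have "\<forall>\<^sub>F n in at_top. a < ((real n / 4 - 1) * (real n / 2 - real t)) / ((real n)\<^sup>2 / 8)"
    using a by (rule order_tendstoD)
  then show "\<forall>\<^sub>F n in at_top. a < ?f n / ((real n)\<^sup>2 / 8)"
    using eventually_ge_at_top[of "4 + 2 * t"]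
  proof eventually_elim
    case (elim n)
    have "((real n / 4 - 1) * (real n / 2 - real t)) / ((real n)\<^sup>2 / 8) \<le> ?f n / ((real n)\<^sup>2 / 8)"
      using rb_ge_real[OF assms elim(2)] by (intro divide_right_mono) auto
    then show ?case using elim(1) by linarith
  qed
next
  let ?f = "\<lambda>n. real (rb n (book t) (book r))"
  fix a :: real assume a: "1 < a"
  \<comment> \<open>The slack (a - 1) / 16 becomes (a - 1) / 2 after division by n^2 / 8, and 1 + (a
    - 1) / 2 is below a.\<close>
  obtain N where N: "\<And>n. N \<le> n \<Longrightarrow> ?f n \<le> (1 / 8 + (a - 1) / 16) * (real n)\<^sup>2"
    using rb_le[of "(a - 1) / 16" t r] a assms(2) by auto
  show "\<forall>\<^sub>F n in at_top. ?f n / ((real n)\<^sup>2 / 8) < a"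
    using eventually_ge_at_top[of "max N 1"]
  proof eventually_elim
    case (elim n)
    then have n: "N \<le> n" "0 < (real n)\<^sup>2" by auto
    have "?f n / ((real n)\<^sup>2 / 8) \<le> (1 / 8 + (a - 1) / 16) * (real n)\<^sup>2 / ((real n)\<^sup>2 / 8)"
      using N[OF n(1)] by (intro divide_right_mono) auto
    also have "\<dots> = 8 * (1 / 8 + (a - 1) / 16)" using n(2) by simp
    also have "\<dots> < a" using a by (simp add: field_simps)
    finally show ?case .
  qed
qed

end
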